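(* Let $\alpha\in\mathbb{R}$, $\beta>0$, and let $T_{[-1,1]}=\inf\{t\ge0:B_t\in[-1,1]\}$ be the first hitting time of the real segment $[-1,1]$ by a planar Brownian motion started at $\sin(\frac\pi2(\alpha+\beta i))$. Then for $x\in(-1,1)$ the density $\rho_{T_{[-1,1]}}$ of $B_{T_{[-1,1]}}$ with respect to arclength on $[-1,1]$ satisfies $$\frac\pi2\cos\Big(\frac\pi2x\Big)\,\rho^{\sin(\frac\pi2(\alpha+\beta i))}_{T_{[-1,1]}}\Big(\sin\Big(\frac\pi2x\Big)\Big)=\frac1\pi\sum_{n=-\infty}^{\infty}\frac{\beta}{\beta^2+\big(\alpha-(2n+(-1)^nx)\big)^2}.$$
   Context: $\rho^{b}_{T_{[-1,1]}}$ denotes the density of $B_{T_{[-1,1]}}$ with respect to Lebesgue (arclength) measure on $[-1,1]$ when $B_0=b$. *)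

theory Defs
  imports "HOL-Probability.Probability"
begin

(* Time is indexed by real, but only the times t \<ge> 0 matter. The increment B t - B s is
   required to be a centred Gaussian vector with covariance (t - s) times the identity:
   its density with respect to planar Lebesgue measure is the product of two
   one-dimensional normal densities. All paths, not just almost all, are continuous,
   so that hitting times are measurable without completing M. *)
locale planar_brownian_motion = prob_space M
  for M :: "'a measure" +
  fixes B :: "real \<Rightarrow> 'a \<Rightarrow> complex" and b :: complex
  assumes B_measurable: "t \<ge> 0 \<Longrightarrow> random_variable borel (B t)"
    and B_start: "AE \<omega> in M. B 0 \<omega> = b"
    and B_continuous: "\<omega> \<in> space M \<Longrightarrow> continuous_on {0..} (\<lambda>t. B t \<omega>)"
    and B_indep_increments:
      "\<lbrakk>0 \<le> \<tau> 0; \<And>i. i < n \<Longrightarrow> \<tau> i \<le> \<tau> (Suc i)\<rbrakk> \<Longrightarrow>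
         indep_vars (\<lambda>_. borel) (\<lambda>(i::nat) \<omega>. B (\<tau> (Suc i)) \<omega> - B (\<tau> i) \<omega>) {..<n}"
    and B_normal_increments:
      "\<lbrakk>0 \<le> s; s < t\<rbrakk> \<Longrightarrow>
         distributed M lborel (\<lambda>\<omega>. B t \<omega> - B s \<omega>)
           (\<lambda>z. ennreal (normal_density 0 (sqrt (t - s)) (Re z) *
                         normal_density 0 (sqrt (t - s)) (Im z)))"

(* The infimum of the empty set is \<infinity>. *)
definition hitting_time :: "(real \<Rightarrow> 'a \<Rightarrow> complex) \<Rightarrow> complex set \<Rightarrow> 'a \<Rightarrow> ereal" where
  "hitting_time B S \<omega> = (INF t \<in> {t. 0 \<le> t \<and> B t \<omega> \<in> S}. ereal t)"

(* Meaningful only where the hitting time is finite. *)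
definition hitting_point :: "(real \<Rightarrow> 'a \<Rightarrow> complex) \<Rightarrow> complex set \<Rightarrow> 'a \<Rightarrow> complex" where
  "hitting_point B S \<omega> = B (real_of_ereal (hitting_time B S \<omega>)) \<omega>"

(* Arclength on the segment from -1 to 1, as a Borel measure on the plane. *)
definition segment_arclength :: "complex measure" where
  "segment_arclength = distr (restrict_space lborel {-1..1}) borel complex_of_real"

(* A density is determined only almost everywhere; continuity on the open segment
   singles out the version whose values at individual points are meant. *)
definition segment_hitting_density ::
  "'a measure \<Rightarrow> (real \<Rightarrow> 'a \<Rightarrow> complex) \<Rightarrow> (complex \<Rightarrow> real) \<Rightarrow> bool" where
  "segment_hitting_density M B \<rho> \<longleftrightarrow>
     (AE \<omega> in M. hitting_time B (closed_segment (-1) 1) \<omega> < \<infinity>) \<and>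
     distributed M segment_arclength (hitting_point B (closed_segment (-1) 1))
       (\<lambda>z. ennreal (\<rho> z)) \<and>
     (\<forall>z\<in>closed_segment (-1) 1. 0 \<le> \<rho> z) \<and>
     continuous_on (open_segment (-1) 1) \<rho>"

end

theory Submission
  imports Defs "HOL-Complex_Analysis.Complex_Analysis"
begin

text \<open>
Let \<open>T\<close> be the hitting time of the slit \<open>[-1, 1]\<close>, \<open>b\<close> the starting point and \<open>w\<close> the inverse of the
Joukowski map \<open>w \<mapsto> (w + 1/w) / 2\<close> that takes the complement of the slit into the unit disc. The
function \<open>Re (w ^ n)\<close> is bounded, harmonic off the slit and continuous on the plane, and its
value at a point \<open>x\<close> of the slit is the Chebyshev polynomial \<open>cos (n arccos x)\<close>. Optional stopping
therefore shows that the \<open>n\<close>-th Chebyshev moment of \<open>B_T\<close> is \<open>Re (w(b) ^ n)\<close>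
(\<open>hitting_point_chebyshev_moment\<close>). For \<open>b = sin (\<pi> (\<alpha> + \<beta> \<i>) / 2)\<close> this is \<open>q ^ n cos (n \<phi>)\<close>,
where \<open>q = exp (- \<pi> \<beta> / 2)\<close> and \<open>\<phi> = \<pi> (1 - \<alpha>) / 2\<close> (\<open>joukowski_inv_sin\<close>).

On the other side, the reflection formula of the Digamma function sums the Cauchy kernels of the
theorem to Poisson kernels, so that the right-hand side of the theorem is the cosine series
\<open>1/2 + (\<Sum>m\<ge>1. q ^ m cos (m \<phi>) cos (m \<theta>))\<close> with \<open>\<theta> = \<pi> (1 - x) / 2\<close> (\<open>angle_density_sums\<close>).
After the substitution of \<open>sin (\<pi> x / 2)\<close>, whose arccosine is \<open>\<theta>\<close>, it is a probability density with the
same Chebyshev moments (\<open>slit_density_chebyshev\<close>). Moments determine a law on a bounded interval, so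
it is the density of \<open>B_T\<close>; any other density that is continuous inside the slit agrees with it there.

Optional stopping (\<open>stopped_expectation_ge\<close>) is proved directly from the Gaussian increments. A
holomorphic function \<open>F\<close> that is bounded by 1 on a disc of radius \<open>\<delta>\<close> differs from its cubic Taylor
polynomial by a multiple of \<open>norm \<zeta> ^ 4 / \<delta> ^ 4\<close>, and the planar Gaussian law annihilates \<open>\<zeta>\<close>, \<open>\<zeta>\<^sup>2\<close> and
\<open>\<zeta>\<^sup>3\<close>. One step of length \<open>h\<close> at distance at least \<open>\<delta>\<close> from the slit thus changes the mean by a
multiple of \<open>h\<^sup>2 / \<delta> ^ 4\<close> at most, and the sum of these errors over \<open>t / h\<close> steps vanishes as \<open>h\<close>
tends to 0. That \<open>T\<close> is finite almost surely (\<open>hits_almost_surely\<close>) follows in the same way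
from the subharmonic functions \<open>norm w powr s\<close> with small \<open>s > 0\<close>.
\<close>

section \<open>The inverse Joukowski map\<close>

text \<open>The inverse of the Joukowski map \<open>w \<mapsto> (w + 1/w) / 2\<close> with values in the closed unit disc. Writing it as
a Cayley transform of \<open>sqrt ((z - 1) / (z + 1))\<close> makes the principal branch of the square root
cut the plane exactly along the slit, and \<open>Re r \<ge> 0\<close> places the value in the disc. At \<open>z = -1\<close>
the quotient degenerates to 0, which would give the value 1, hence the separate case.\<close>

definition joukowski_inv :: "complex \<Rightarrow> complex" where
  "joukowski_inv z = (if z = -1 then -1
     else (let r = csqrt ((z - 1) / (z + 1)) in (1 - r) / (1 + r)))"

lemma one_plus_eq_0_iff: "1 + r = 0 \<longleftrightarrow> r = (-1 :: complex)" "r + 1 = 0 \<longleftrightarrow> r = (-1 :: complex)"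
  by (auto simp: complex_eq_iff)

lemma joukowski_inv_cases:
  assumes "z \<noteq> -1"
  obtains r where "Re r \<ge> 0" "r\<^sup>2 = (z - 1) / (z + 1)" "r \<noteq> 1" "r \<noteq> -1"
    "joukowski_inv z = (1 - r) / (1 + r)" "r = csqrt ((z - 1) / (z + 1))"
proof -
  define r where "r = csqrt ((z - 1) / (z + 1))"
  have sq: "r\<^sup>2 = (z - 1) / (z + 1)" by (simp add: r_def)
  have "z + 1 \<noteq> 0" using assms by (simp add: add_eq_0_iff2)
  then have "r\<^sup>2 \<noteq> 1" unfolding sq by (simp add: field_simps)
  then have "r \<noteq> 1" "r \<noteq> -1" by auto
  moreover have "Re r \<ge> 0" unfolding r_def using csqrt_principal[of "(z - 1) / (z + 1)"] by linarith
  ultimately show thesis using that[of r] sq assms by (simp add: joukowski_inv_def Let_def r_def)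
qed

lemma joukowski_inv_nonzero: "joukowski_inv z \<noteq> 0"
proof (cases "z = -1")
  case False
  then obtain r where "r \<noteq> 1" "r \<noteq> -1" "joukowski_inv z = (1 - r) / (1 + r)"
    using joukowski_inv_cases by metis
  then show ?thesis using one_plus_eq_0_iff(1)[of r] by auto
qed (simp add: joukowski_inv_def)

lemma joukowski_joukowski_inv: "joukowski_inv z + inverse (joukowski_inv z) = 2 * z"
proof (cases "z = -1")
  case False
  then obtain r where r: "r\<^sup>2 = (z - 1) / (z + 1)" "r \<noteq> 1" "r \<noteq> -1"
      "joukowski_inv z = (1 - r) / (1 + r)"
    using joukowski_inv_cases by metis
  have nz: "z + 1 \<noteq> 0" "1 - r \<noteq> 0" "1 + r \<noteq> 0"
    using False r by (simp_all add: one_plus_eq_0_iff)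
  have "r\<^sup>2 * (z + 1) = z - 1" using r(1) nz by simp
  then have "(1 - r)\<^sup>2 + (1 + r)\<^sup>2 = 2 * z * ((1 - r) * (1 + r))" by algebra
  then have "((1 - r)\<^sup>2 + (1 + r)\<^sup>2) / ((1 - r) * (1 + r)) = 2 * z" using nz by simp
  moreover have "(1 - r) / (1 + r) + inverse ((1 - r) / (1 + r)) = ((1 - r)\<^sup>2 + (1 + r)\<^sup>2) / ((1 - r) * (1 + r))"
    using nz(2,3) by (simp add: add_frac_eq power2_eq_square mult.commute)
  ultimately show ?thesis unfolding r(4) by simp
qed (simp add: joukowski_inv_def)

lemma norm_joukowski_inv_le_1: "norm (joukowski_inv z) \<le> 1"
proof (cases "z = -1")
  case False
  then obtain r where r: "Re r \<ge> 0" "r \<noteq> -1" "joukowski_inv z = (1 - r) / (1 + r)"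
    using joukowski_inv_cases by metis
  have "(norm (1 - r))\<^sup>2 \<le> (norm (1 + r))\<^sup>2"
    unfolding cmod_power2 using r(1) by (simp add: power2_eq_square algebra_simps)
  then have "norm (1 - r) \<le> norm (1 + r)" by simp
  then show ?thesis unfolding r(3) by (simp add: norm_divide divide_le_eq_1)
qed (simp add: joukowski_inv_def)

text \<open>The level sets of \<open>norm (joukowski_inv z)\<close> are the ellipses with foci 1 and -1. This makes the norm an
explicit continuous function of \<open>z\<close>, also across the slit, where the map itself jumps.\<close>

lemma norm_joukowski_inv_ellipse:
  "norm (joukowski_inv z) + 1 / norm (joukowski_inv z) = norm (z - 1) + norm (z + 1)"
proof -
  define w where "w = joukowski_inv z"
  have w: "w \<noteq> 0" by (simp add: w_def joukowski_inv_nonzero)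
  have z: "z = (w + inverse w) / 2" using joukowski_joukowski_inv[of z] by (simp add: w_def)
  have "z - 1 = (w - 1)\<^sup>2 / (2 * w)" "z + 1 = (w + 1)\<^sup>2 / (2 * w)"
    unfolding z using w by (auto simp: field_simps power2_eq_square)
  then have "norm (z - 1) + norm (z + 1) = ((norm (w - 1))\<^sup>2 + (norm (w + 1))\<^sup>2) / (2 * norm w)"
    by (simp add: norm_divide norm_power norm_mult add_divide_distrib)
  also have "(norm (w - 1))\<^sup>2 + (norm (w + 1))\<^sup>2 = 2 * (norm w)\<^sup>2 + 2"
    unfolding cmod_power2 by (simp add: power2_eq_square algebra_simps)
  also have "(2 * (norm w)\<^sup>2 + 2) / (2 * norm w) = norm w + 1 / norm w"
    using w by (simp add: field_simps power2_eq_square)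
  finally show ?thesis by (simp add: w_def)
qed

lemma norm_joukowski_inv_eq:
  "norm (joukowski_inv z) = ((norm (z - 1) + norm (z + 1)) - sqrt ((norm (z - 1) + norm (z + 1))\<^sup>2 - 4)) / 2"
proof -
  define a where "a = norm (joukowski_inv z)"
  have a: "0 < a" "a \<le> 1" by (auto simp: a_def joukowski_inv_nonzero norm_joukowski_inv_le_1)
  have "(a + 1 / a)\<^sup>2 - 4 = (1 / a - a)\<^sup>2" using a by (simp add: field_simps power2_eq_square)
  moreover have "1 / a - a \<ge> 0" using a by (simp add: field_simps mult_le_one)
  ultimately have "sqrt ((a + 1 / a)\<^sup>2 - 4) = 1 / a - a" by simp
  then show ?thesis unfolding norm_joukowski_inv_ellipse[symmetric] a_def[symmetric] by simp
qed

lemma continuous_on_norm_joukowski_inv: "continuous_on A (\<lambda>z. norm (joukowski_inv z))"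
  unfolding norm_joukowski_inv_eq by (intro continuous_intros) auto

text \<open>With \<open>w\<close> the value of the inverse map, \<open>w ^ n + 1 / w ^ n\<close> is a polynomial in \<open>z\<close> (twice a Chebyshev
polynomial), and its real part is \<open>Re (w ^ n)\<close> times \<open>1 + 1 / norm w ^ (2 n)\<close>. Dividing by this
continuous positive factor gives continuity on the whole plane, with no discussion of the two
sides of the slit.\<close>

lemma continuous_on_Re_joukowski_inv_power:
  "continuous_on A (\<lambda>z. Re (joukowski_inv z ^ n))"
proof -
  let ?w = joukowski_inv
  have T: "continuous_on A (\<lambda>z. ?w z ^ n + inverse (?w z) ^ n)"
  proof (induction n rule: induct_nat_012)
    case (ge2 n)
    have eq: "?w z ^ Suc (Suc n) + inverse (?w z) ^ Suc (Suc n) =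
        2 * z * (?w z ^ Suc n + inverse (?w z) ^ Suc n) - (?w z ^ n + inverse (?w z) ^ n)" for z
      unfolding joukowski_joukowski_inv[symmetric] using joukowski_inv_nonzero[of z]
      by (simp add: field_simps)
    show ?case unfolding eq by (intro continuous_intros ge2.IH)
  qed (auto simp: joukowski_joukowski_inv intro!: continuous_intros)
  have eq: "Re (?w z ^ n) = Re (?w z ^ n + inverse (?w z) ^ n) / (1 + inverse (norm (?w z)) ^ (2 * n))" for z
  proof -
    define c where "c = inverse (norm (?w z)) ^ (2 * n)"
    have inv: "inverse (?w z) ^ n = cnj (?w z ^ n) * of_real c"
    proof -
      have "inverse (?w z) = cnj (?w z) * of_real (inverse (norm (?w z)) ^ 2)"
        using joukowski_inv_nonzero[of z]
        by (simp add: divide_simps complex_norm_square[symmetric] mult.commute)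
      then show ?thesis by (simp add: c_def power_mult_distrib power_mult)
    qed
    have "Re (?w z ^ n + inverse (?w z) ^ n) = Re (?w z ^ n) * (1 + c)"
      unfolding inv by (simp add: algebra_simps del: complex_cnj_power)
    moreover have "1 + c > 0"
      unfolding c_def by (intro add_pos_nonneg) auto
    ultimately show ?thesis by (simp add: c_def)
  qed
  show ?thesis
    unfolding eq
  proof (intro continuous_on_divide[OF continuous_on_Re[OF T]] continuous_on_add continuous_on_power
      continuous_on_inverse continuous_on_const continuous_on_norm_joukowski_inv ballI)
    fix z show "1 + inverse (norm (?w z)) ^ (2 * n) \<noteq> 0"
      by (smt (verit) inverse_nonnegative_iff_nonnegative norm_ge_zero zero_le_power)
  qed (auto simp: joukowski_inv_nonzero)
qed

lemma mem_unit_segment_iff: "z \<in> closed_segment (-1) (1::complex) \<longleftrightarrow> Im z = 0 \<and> \<bar>Re z\<bar> \<le> 1"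
proof
  assume "z \<in> closed_segment (-1) 1"
  then obtain u where "0 \<le> u" "u \<le> 1" "z = (1 - u) *\<^sub>R (-1) + u *\<^sub>R 1"
    by (auto simp: closed_segment_def)
  then show "Im z = 0 \<and> \<bar>Re z\<bar> \<le> 1" by (auto simp: abs_if)
next
  assume *: "Im z = 0 \<and> \<bar>Re z\<bar> \<le> 1"
  then have "z = (1 - (1 + Re z) / 2) *\<^sub>R (-1) + ((1 + Re z) / 2) *\<^sub>R 1"
    by (auto simp: complex_eq_iff field_simps)
  then show "z \<in> closed_segment (-1) 1"
    unfolding closed_segment_def using * by (intro CollectI exI[of _ "(1 + Re z) / 2"]) auto
qed

lemma holomorphic_joukowski_inv: "joukowski_inv holomorphic_on - closed_segment (-1) 1"
proof -
  have "(\<lambda>z. (1 - csqrt ((z - 1) / (z + 1))) / (1 + csqrt ((z - 1) / (z + 1)))) holomorphic_on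
      - closed_segment (-1) 1"
  proof -
    have n: "z + 1 \<noteq> 0" if z: "z \<in> - closed_segment (-1) 1" for z :: complex using z by (auto simp: mem_unit_segment_iff add_eq_0_iff2)
    have m: "(z - 1) / (z + 1) \<notin> \<real>\<^sub>\<le>\<^sub>0" if z: "z \<in> - closed_segment (-1) 1" for z :: complex
    proof
      assume "(z - 1) / (z + 1) \<in> \<real>\<^sub>\<le>\<^sub>0"
      then obtain s where s: "(z - 1) / (z + 1) = of_real s" "s \<le> 0"
        by (auto simp: nonpos_Reals_def)
      then have "z * of_real (1 - s) = of_real (1 + s)" using n[OF z] by (simp add: field_simps)
      then have "Re z * (1 - s) = 1 + s" "Im z * (1 - s) = 0"
        by (auto simp: complex_eq_iff)
      moreover have pos: "1 - s > 0" using s(2) by simp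
      moreover have "Re z * (1 - s) \<le> 1 * (1 - s)" "-1 * (1 - s) \<le> Re z * (1 - s)"
        unfolding \<open>Re z * (1 - s) = 1 + s\<close> using s(2) by simp_all
      then have "Re z \<le> 1" "-1 \<le> Re z" using mult_right_le_imp_le[OF _ pos] by blast+
      ultimately have "Im z = 0 \<and> \<bar>Re z\<bar> \<le> 1" by simp
      then show False using z by (simp add: mem_unit_segment_iff)
    qed
    have "1 + csqrt ((z - 1) / (z + 1)) \<noteq> 0" if z: "z \<in> - closed_segment (-1) 1" for z :: complex
      using n[OF z] joukowski_inv_cases[of z] one_plus_eq_0_iff by metis
    with n m show ?thesis by (intro holomorphic_intros)
  qed
  then show ?thesis
    by (rule holomorphic_transform) (auto simp: joukowski_inv_def Let_def)
qed

text \<open>The equation \<open>v + 1/v = 2 z\<close> has two roots with product 1, so at most one lies inside the disc.\<close>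

lemma joukowski_inv_unique:
  assumes "norm v < 1" "v \<noteq> 0" "v + inverse v = 2 * z"
  shows "joukowski_inv z = v"
proof -
  define w where "w = joukowski_inv z"
  have w: "w \<noteq> 0" "norm w \<le> 1" "w + inverse w = 2 * z"
    by (auto simp: w_def joukowski_inv_nonzero norm_joukowski_inv_le_1 joukowski_joukowski_inv)
  have "(w - v) * (w * v - 1) = w * v * ((w + inverse w) - (v + inverse v))"
    using w(1) assms(2) by (simp add: field_simps)
  also have "\<dots> = 0" unfolding w(3) assms(3) by simp
  finally have "(w - v) * (w * v - 1) = 0" .
  moreover have "norm (w * v) < 1"
    using mult_right_mono[of "norm w" 1 "norm v"] w(2) assms(1) by (simp add: norm_mult)
  then have "w * v \<noteq> 1" by auto
  ultimately show ?thesis by (simp add: w_def)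
qed

text \<open>On the slit \<open>norm w = 1\<close>, hence \<open>1/w = cnj w\<close> and \<open>Re w = z\<close>: the boundary values are the
Chebyshev polynomials.\<close>

lemma Re_joukowski_inv_power_segment:
  assumes "z \<in> closed_segment (-1) 1"
  shows "Re (joukowski_inv z ^ n) = cos (real n * arccos (Re z))"
proof -
  obtain x where x: "z = of_real x" "\<bar>x\<bar> \<le> 1"
    using assms by (auto simp: mem_unit_segment_iff complex_eq_iff intro: that[of "Re z"])
  have "norm (z - 1) + norm (z + 1) = 2"
  proof -
    have "norm (z - 1) = \<bar>x - 1\<bar>" "norm (z + 1) = \<bar>x + 1\<bar>"
      unfolding x by (metis norm_of_real of_real_1 of_real_diff of_real_add)+
    then show ?thesis using x(2) by linarith
  qed
  then have n: "norm (joukowski_inv z) = 1" unfolding norm_joukowski_inv_eq by simp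
  define w where "w = joukowski_inv z"
  have "inverse w = cnj w"
    using n by (simp add: w_def inverse_complex_def complex_eq_iff cmod_def)
  then have "Re w = x"
    using joukowski_joukowski_inv[of z] by (simp add: w_def x(1) complex_eq_iff)
  moreover have "(Re w)\<^sup>2 + (Im w)\<^sup>2 = 1" using n by (simp add: w_def cmod_def)
  ultimately have "(Im w)\<^sup>2 = (sin (arccos x))\<^sup>2"
    using x(2) by (simp add: sin_arccos_abs abs_square_le_1)
  then have "Im w = sin (arccos x) \<or> Im w = - sin (arccos x)" by (simp add: power2_eq_iff)
  then have "w = cis (arccos x) \<or> w = cis (- arccos x)"
    using \<open>Re w = x\<close> x(2) by (auto simp: complex_eq_iff cos_arccos_abs)
  then show "Re (joukowski_inv z ^ n) = cos (real n * arccos (Re z))"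
    unfolding w_def[symmetric] using x(1) by (auto simp: Complex.DeMoivre)
qed

section \<open>The planar Gaussian kernel\<close>

lemma lborel_complex_eq: "lborel = distr (lborel \<Otimes>\<^sub>M lborel) borel (\<lambda>(x, y). Complex x y)"
proof (rule lborel_eqI)
  have m: "(\<lambda>(x, y). Complex x y) \<in> borel_measurable (lborel \<Otimes>\<^sub>M lborel)"
    unfolding Complex_eq by measurable
  fix l u :: complex assume lu: "\<And>b. b \<in> Basis \<Longrightarrow> l \<bullet> b \<le> u \<bullet> b"
  have le: "Re l \<le> Re u" "Im l \<le> Im u"
    using lu[of 1] lu[of \<i>] by (auto simp: Basis_complex_def)
  have "(\<lambda>(x, y). Complex x y) -` box l u = {Re l<..<Re u} \<times> {Im l<..<Im u}"
    by (auto simp: box_def Basis_complex_def)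
  then have "emeasure (distr (lborel \<Otimes>\<^sub>M lborel) borel (\<lambda>(x, y). Complex x y)) (box l u) =
      emeasure (lborel \<Otimes>\<^sub>M lborel) ({Re l<..<Re u} \<times> {Im l<..<Im u})"
    using m by (simp add: emeasure_distr space_pair_measure)
  also have "\<dots> = ennreal (Re u - Re l) * ennreal (Im u - Im l)"
    using le by (simp add: lborel.emeasure_pair_measure_Times)
  also have "\<dots> = ennreal (\<Prod>b\<in>Basis. (u - l) \<bullet> b)"
    using le by (simp add: Basis_complex_def ennreal_mult' )
  finally show "emeasure (distr (lborel \<Otimes>\<^sub>M lborel) borel (\<lambda>(x, y). Complex x y)) (box l u) =
      ennreal (\<Prod>b\<in>Basis. (u - l) \<bullet> b)" .
qed simp

lemma has_bochner_integral_lborel_complex_product: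
  fixes f g :: "real \<Rightarrow> real"
  assumes f: "has_bochner_integral lborel f a" and g: "has_bochner_integral lborel g b"
  shows "has_bochner_integral lborel (\<lambda>z. f (Re z) * g (Im z)) (a * b)"
proof -
  have [measurable]: "f \<in> borel_measurable borel" "g \<in> borel_measurable borel"
    using f g by (auto simp: has_bochner_integral_iff dest!: borel_measurable_integrable)
  have m: "(\<lambda>(x, y). Complex x y) \<in> borel_measurable (lborel \<Otimes>\<^sub>M lborel)"
    unfolding Complex_eq by measurable
  have int: "integrable lborel f" "integrable lborel g" "integral\<^sup>L lborel f = a" "integral\<^sup>L lborel g = b"
    using f g by (auto simp: has_bochner_integral_iff)
  have i: "integrable (lborel \<Otimes>\<^sub>M lborel) (\<lambda>(x, y). f x * g y)"
    by (rule lborel_pair.Fubini_integrable) (auto simp: norm_mult int abs_mult)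
  have "(\<integral>p. (case p of (x, y) \<Rightarrow> f x * g y) \<partial>(lborel \<Otimes>\<^sub>M lborel)) = (\<integral>x. \<integral>y. f x * g y \<partial>lborel \<partial>lborel)"
    using lborel_pair.integral_fst'[OF i] by simp
  also have "\<dots> = a * b" by (simp add: int)
  finally have "has_bochner_integral (lborel \<Otimes>\<^sub>M lborel) (\<lambda>(x, y). f x * g y) (a * b)"
    using i by (simp add: has_bochner_integral_iff)
  then have "has_bochner_integral (lborel \<Otimes>\<^sub>M lborel)
      (\<lambda>p. (\<lambda>z. f (Re z) * g (Im z)) ((\<lambda>(x, y). Complex x y) p)) (a * b)"
    by (simp add: case_prod_beta')
  then have "has_bochner_integral (distr (lborel \<Otimes>\<^sub>M lborel) borel (\<lambda>(x, y). Complex x y))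
      (\<lambda>z. f (Re z) * g (Im z)) (a * b)"
    unfolding has_bochner_integral_iff using m
    by (subst integrable_distr_eq, simp, simp, subst integral_distr) auto
  then show ?thesis unfolding lborel_complex_eq[symmetric] .
qed

definition planar_normal_density :: "real \<Rightarrow> complex \<Rightarrow> real" where
  "planar_normal_density \<sigma> z = normal_density 0 \<sigma> (Re z) * normal_density 0 \<sigma> (Im z)"

lemma planar_normal_density_nonneg: "planar_normal_density \<sigma> z \<ge> 0"
  by (simp add: planar_normal_density_def)

lemma borel_measurable_planar_normal_density [measurable]:
  "planar_normal_density \<sigma> \<in> borel_measurable borel"
  unfolding planar_normal_density_def by measurable

context
  fixes \<sigma> :: real
  assumes \<sigma>: "\<sigma> > 0"
begin

lemma has_bochner_integral_planar_normal_moment: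
  "has_bochner_integral lborel (\<lambda>z. planar_normal_density \<sigma> z * (Re z ^ j * Im z ^ k))
     ((\<integral>x. normal_density 0 \<sigma> x * x ^ j \<partial>lborel) * (\<integral>x. normal_density 0 \<sigma> x * x ^ k \<partial>lborel))"
proof -
  have "has_bochner_integral lborel (\<lambda>x. normal_density 0 \<sigma> x * x ^ k) (\<integral>x. normal_density 0 \<sigma> x * x ^ k \<partial>lborel)" for k
    using integrable_normal_moment[OF \<sigma>, of 0 k] by (simp add: has_bochner_integral_iff)
  from has_bochner_integral_lborel_complex_product[OF this this, of j k]
  show ?thesis by (simp add: planar_normal_density_def mult_ac)
qed

lemma normal_moments:
  shows "(\<integral>x. normal_density 0 \<sigma> x * x ^ 0 \<partial>lborel) = 1"
    "(\<integral>x. normal_density 0 \<sigma> x * x ^ 1 \<partial>lborel) = 0"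
    "(\<integral>x. normal_density 0 \<sigma> x * x ^ 2 \<partial>lborel) = \<sigma>\<^sup>2"
    "(\<integral>x. normal_density 0 \<sigma> x * x ^ 3 \<partial>lborel) = 0"
    "(\<integral>x. normal_density 0 \<sigma> x * x ^ 4 \<partial>lborel) = 3 * \<sigma> ^ 4"
  using integral_normal_moment_even[OF \<sigma>, of 0 0] integral_normal_moment_odd[OF \<sigma>, of 0 0]
    integral_normal_moment_even[OF \<sigma>, of 0 1] integral_normal_moment_odd[OF \<sigma>, of 0 1]
    integral_normal_moment_even[OF \<sigma>, of 0 2]
  by (simp_all add: fact_numeral power2_eq_square field_simps eval_nat_numeral)

lemma planar_normal_density_integral: "has_bochner_integral lborel (planar_normal_density \<sigma>) 1"
  using has_bochner_integral_planar_normal_moment[of 0 0] normal_moments by simp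

text \<open>The planar Gaussian law is invariant under \<open>z \<mapsto> \<i> z\<close>, which multiplies the mean of \<open>z ^ k\<close> by a
power of \<open>\<i>\<close> different from 1 for \<open>k = 1, 2, 3\<close>. The proof computes the moments from those of the coordinates.\<close>

lemma planar_normal_density_power_integral:
  assumes "k \<in> {1, 2, 3}"
  shows "has_bochner_integral lborel (\<lambda>z. planar_normal_density \<sigma> z * Re (a * z ^ k)) 0"
proof -
  note m = has_bochner_integral_planar_normal_moment
  note nm = normal_moments[simplified]
  have re: "has_bochner_integral lborel (\<lambda>z. planar_normal_density \<sigma> z * Re (z ^ k)) 0"
    using assms
  proof (elim insertE emptyE)
    assume "k = 1"
    then show ?thesis using m[of 1 0] by (simp add: nm)
  next
    assume "k = 2"
    then show ?thesis
      using has_bochner_integral_diff[OF m[of 2 0] m[of 0 2]] by (simp add: nm algebra_simps Re_power2)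
  next
    assume k: "k = 3"
    have c: "Re (z ^ 3) = Re z ^ 3 * Im z ^ 0 - 3 * (Re z ^ 1 * Im z ^ 2)" for z
      by (simp add: power3_eq_cube power2_eq_square algebra_simps)
    have eq: "planar_normal_density \<sigma> z * Re (z ^ 3) = planar_normal_density \<sigma> z * (Re z ^ 3 * Im z ^ 0) -
        3 * (planar_normal_density \<sigma> z * (Re z ^ 1 * Im z ^ 2))" for z unfolding c by (simp add: algebra_simps)
    show ?thesis unfolding k eq
      using has_bochner_integral_diff[OF m[of 3 0] has_bochner_integral_mult_right[OF m[of 1 2], of 3]]
      unfolding normal_moments by simp
  qed
  have im: "has_bochner_integral lborel (\<lambda>z. planar_normal_density \<sigma> z * Im (z ^ k)) 0"
    using assms
  proof (elim insertE emptyE)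
    assume "k = 1"
    then show ?thesis using m[of 0 1] by (simp add: nm)
  next
    assume k: "k = 2"
    have eq: "planar_normal_density \<sigma> z * Im (z\<^sup>2) = 2 * (planar_normal_density \<sigma> z * (Re z ^ 1 * Im z ^ 1))" for z
      by (simp add: Im_power2)
    show ?thesis unfolding k eq
      using has_bochner_integral_mult_right[OF m[of 1 1], of 2] unfolding normal_moments by simp
  next
    assume k: "k = 3"
    have c: "Im (z ^ 3) = 3 * (Re z ^ 2 * Im z ^ 1) - Re z ^ 0 * Im z ^ 3" for z
      by (simp add: power3_eq_cube power2_eq_square algebra_simps)
    have eq: "planar_normal_density \<sigma> z * Im (z ^ 3) = 3 * (planar_normal_density \<sigma> z * (Re z ^ 2 * Im z ^ 1)) -
        planar_normal_density \<sigma> z * (Re z ^ 0 * Im z ^ 3)" for z unfolding c by (simp add: algebra_simps)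
    show ?thesis unfolding k eq
      using has_bochner_integral_diff[OF has_bochner_integral_mult_right[OF m[of 2 1], of 3] m[of 0 3]]
      unfolding normal_moments by simp
  qed
  show ?thesis
    using has_bochner_integral_diff[OF has_bochner_integral_mult_right[OF re, of "Re a"]
        has_bochner_integral_mult_right[OF im, of "Im a"]]
    by (simp add: algebra_simps)
qed

lemma planar_normal_density_norm4_integral:
  shows "integrable lborel (\<lambda>z. planar_normal_density \<sigma> z * norm z ^ 4)"
    and "(\<integral>z. planar_normal_density \<sigma> z * norm z ^ 4 \<partial>lborel) = 8 * \<sigma> ^ 4"
proof -
  note m = has_bochner_integral_planar_normal_moment
  have "norm z ^ 4 = Re z ^ 4 * Im z ^ 0 + 2 * (Re z ^ 2 * Im z ^ 2) + Re z ^ 0 * Im z ^ 4" for z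
  proof -
    have "norm z ^ 4 = ((norm z)\<^sup>2)\<^sup>2" by simp
    also have "\<dots> = ((Re z)\<^sup>2 + (Im z)\<^sup>2)\<^sup>2" by (simp only: cmod_power2)
    finally show ?thesis by (simp add: power2_eq_square eval_nat_numeral algebra_simps)
  qed
  then have "has_bochner_integral lborel (\<lambda>z. planar_normal_density \<sigma> z * norm z ^ 4) (8 * \<sigma> ^ 4)"
    using has_bochner_integral_add[OF has_bochner_integral_add[OF m[of 4 0]
      has_bochner_integral_mult_right[OF m[of 2 2], of 2]] m[of 0 4]]
    by (simp add: normal_moments[simplified] algebra_simps flip: power_add)
  then show "integrable lborel (\<lambda>z. planar_normal_density \<sigma> z * norm z ^ 4)"
    "(\<integral>z. planar_normal_density \<sigma> z * norm z ^ 4 \<partial>lborel) = 8 * \<sigma> ^ 4"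
    by (auto simp: has_bochner_integral_iff)
qed

end

text \<open>Cauchy's inequalities bound the coefficients and the fourth derivative by the radius alone.
Order four is what is needed: the cubic polynomial has a Gaussian mean equal to its constant
term, and a remainder of order \<open>norm \<zeta> ^ 4\<close> has a mean of the order of the square of the time step.\<close>

lemma holomorphic_cubic_Taylor_bound:
  assumes hol: "F holomorphic_on ball z \<delta>" and bd: "\<And>y. y \<in> ball z \<delta> \<Longrightarrow> norm (F y) \<le> 1"
    and \<delta>: "\<delta> > 0"
  obtains a where "a 0 = F z" "\<And>k. norm (a k) \<le> (2 / \<delta>) ^ k"
    "\<And>\<zeta>. norm \<zeta> < \<delta> / 2 \<Longrightarrow> norm (F (z + \<zeta>) - (\<Sum>k\<le>3. a k * \<zeta> ^ k)) \<le> 1024 * (norm \<zeta> / \<delta>) ^ 4"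
proof -
  have cauchy: "norm ((deriv ^^ k) F w) \<le> fact k * 1 / r ^ k"
    if "cball w r \<subseteq> ball z \<delta>" "r > 0" for k w r
  proof (rule Cauchy_inequality)
    show "F holomorphic_on ball w r" using that(1) ball_subset_cball hol by (meson holomorphic_on_subset subset_trans)
    show "continuous_on (cball w r) F"
      using that(1) hol by (meson holomorphic_on_imp_continuous_on holomorphic_on_subset)
    show "norm (F x) \<le> 1" if "norm (w - x) = r" for x
      using \<open>cball w r \<subseteq> ball z \<delta>\<close> that by (intro bd) (auto simp: dist_norm)
  qed (use that in auto)
  have sub: "cball w (\<delta> / 4) \<subseteq> ball z \<delta>" if "w \<in> ball z (\<delta> / 2)" for w
    using that \<delta> by (simp add: cball_subset_ball_iff dist_commute)
  define a where "a k = (deriv ^^ k) F z / fact k" for k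
  show thesis
  proof
    show "a 0 = F z" by (simp add: a_def)
    show "norm (a k) \<le> (2 / \<delta>) ^ k" for k
    proof -
      have "cball z (\<delta> / 2) \<subseteq> ball z \<delta>" using \<delta> by auto
      from cauchy[OF this, of k] \<delta> show ?thesis
        by (simp add: a_def norm_divide field_simps power_divide)
    qed
    fix \<zeta> :: complex assume \<zeta>: "norm \<zeta> < \<delta> / 2"
    \<comment> \<open>\<open>cball w (\<delta> / 4)\<close> lies in the large ball for each \<open>w\<close> of the half ball, so the fourth
      derivative is at most \<open>24 (4 / \<delta>)\<^sup>4\<close> there, and \<open>24 \<cdot> 256 / 3! = 1024\<close>.\<close>
    have "norm ((deriv ^^ 0) F (z + \<zeta>) - (\<Sum>i\<le>3. (deriv ^^ i) F z * (z + \<zeta> - z) ^ i / fact i))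
        \<le> (fact 4 / (\<delta> / 4) ^ 4) * norm (z + \<zeta> - z) ^ Suc 3 / fact 3"
    proof (rule complex_Taylor[where S = "ball z (\<delta> / 2)"])
      show "((deriv ^^ i) F has_field_derivative (deriv ^^ Suc i) F x) (at x within ball z (\<delta> / 2))"
        if "x \<in> ball z (\<delta> / 2)" for i x
      proof -
        have "(deriv ^^ i) F holomorphic_on ball z \<delta>" by (intro holomorphic_higher_deriv hol) auto
        moreover have "x \<in> ball z \<delta>" using that \<delta> by auto
        ultimately show ?thesis
          using holomorphic_derivI[of "(deriv ^^ i) F" "ball z \<delta>" x] by (simp add: DERIV_subset)
      qed
      show "norm ((deriv ^^ Suc 3) F x) \<le> fact 4 / (\<delta> / 4) ^ 4" if "x \<in> ball z (\<delta> / 2)" for x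
        using cauchy[OF sub[OF that], of 4] \<delta> by (simp add: eval_nat_numeral)
    qed (use \<zeta> \<delta> in \<open>auto simp: dist_norm\<close>)
    also have "(fact 4 / (\<delta> / 4) ^ 4) * norm (z + \<zeta> - z) ^ Suc 3 / fact 3 = 1024 * (norm \<zeta> / \<delta>) ^ 4"
      by (simp add: fact_numeral power_divide)
    finally show "norm (F (z + \<zeta>) - (\<Sum>k\<le>3. a k * \<zeta> ^ k)) \<le> 1024 * (norm \<zeta> / \<delta>) ^ 4"
      by (simp add: a_def)
  qed
qed

text \<open>A quantitative sub-mean value inequality. A single holomorphic function touching \<open>u\<close> from below
at \<open>z\<close> suffices, and nothing but boundedness is asked of \<open>u\<close> far from \<open>z\<close>: a jump longer than
\<open>\<delta> / 2\<close> is so unlikely for small \<open>\<sigma>\<close> that it is absorbed in the error.\<close>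

lemma planar_normal_submean:
  fixes u :: "complex \<Rightarrow> real"
  assumes \<sigma>: "\<sigma> > 0" and \<delta>: "\<delta> > 0"
    and [measurable]: "u \<in> borel_measurable borel" and u: "\<And>y. \<bar>u y\<bar> \<le> 1"
    and hol: "F holomorphic_on ball z \<delta>" and bd: "\<And>y. y \<in> ball z \<delta> \<Longrightarrow> norm (F y) \<le> 1"
    and le: "\<And>y. y \<in> ball z \<delta> \<Longrightarrow> Re (F y) \<le> u y" and eq: "Re (F z) = u z"
  shows "(\<integral>\<zeta>. planar_normal_density \<sigma> \<zeta> * u (z + \<zeta>) \<partial>lborel) \<ge> u z - 8192 * (\<sigma> / \<delta>) ^ 4"
proof -
  obtain a where a: "a 0 = F z" "\<And>k. norm (a k) \<le> (2 / \<delta>) ^ k"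
    "\<And>\<zeta>. norm \<zeta> < \<delta> / 2 \<Longrightarrow> norm (F (z + \<zeta>) - (\<Sum>k\<le>3. a k * \<zeta> ^ k)) \<le> 1024 * (norm \<zeta> / \<delta>) ^ 4"
    using holomorphic_cubic_Taylor_bound[OF hol bd \<delta>] by blast
  define P where "P \<zeta> = (\<Sum>k\<le>3. a k * \<zeta> ^ k)" for \<zeta>
  define g where "g = planar_normal_density \<sigma>"
  \<comment> \<open>The cubic Taylor polynomial minus a quartic is a minorant of \<open>u (z + \<zeta>)\<close> on the whole
    plane: by Taylor's bound near 0, and by the growth of the quartic elsewhere.\<close>
  have ptw: "Re (P \<zeta>) - 1024 / \<delta> ^ 4 * norm \<zeta> ^ 4 \<le> u (z + \<zeta>)" for \<zeta>
  proof (cases "norm \<zeta> < \<delta> / 2")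
    case True
    then have "z + \<zeta> \<in> ball z \<delta>" using \<delta> by (auto simp: dist_norm)
    then have "Re (F (z + \<zeta>)) \<le> u (z + \<zeta>)" by (rule le)
    moreover have "Re (P \<zeta> - F (z + \<zeta>)) \<le> norm (P \<zeta> - F (z + \<zeta>))" by (rule complex_Re_le_cmod)
    ultimately show ?thesis
      using a(3)[OF True] by (simp add: P_def norm_minus_commute power_divide)
  next
    case False
    define s where "s = 2 * norm \<zeta> / \<delta>"
    have s: "s \<ge> 1" using False \<delta> by (simp add: s_def field_simps)
    have "norm (a k * \<zeta> ^ k) \<le> s ^ 4" if "k \<le> 3" for k
    proof -
      have "norm (a k * \<zeta> ^ k) \<le> (2 / \<delta>) ^ k * norm \<zeta> ^ k"
        unfolding norm_mult norm_power by (intro mult_right_mono a) auto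
      also have "\<dots> = s ^ k" by (simp add: s_def power_divide power_mult_distrib)
      also have "\<dots> \<le> s ^ 4" using s that by (intro power_increasing) auto
      finally show ?thesis .
    qed
    then have "norm (P \<zeta>) \<le> (\<Sum>k\<le>(3::nat). s ^ 4)" unfolding P_def by (intro sum_norm_le) auto
    then have "Re (P \<zeta>) \<le> 4 * s ^ 4" using complex_Re_le_cmod[of "P \<zeta>"] by simp
    moreover have "1 \<le> s ^ 4" using s by simp
    moreover have "- 1 \<le> u (z + \<zeta>)" using u[of "z + \<zeta>"] by (simp add: abs_le_iff)
    moreover have "s ^ 4 = 16 * (1 / \<delta> ^ 4 * norm \<zeta> ^ 4)" by (simp add: s_def power_divide power_mult_distrib)
    ultimately show ?thesis by simp
  qed
  have int: "integrable lborel g" "integral\<^sup>L lborel g = 1"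
    using planar_normal_density_integral[OF \<sigma>] by (auto simp: g_def has_bochner_integral_iff)
  have i4: "integrable lborel (\<lambda>\<zeta>. g \<zeta> * norm \<zeta> ^ 4)" "(\<integral>\<zeta>. g \<zeta> * norm \<zeta> ^ 4 \<partial>lborel) = 8 * \<sigma> ^ 4"
    using planar_normal_density_norm4_integral[OF \<sigma>] by (auto simp: g_def)
  have P: "has_bochner_integral lborel (\<lambda>\<zeta>. g \<zeta> * Re (P \<zeta>)) (u z)"
  proof -
    have *: "has_bochner_integral lborel (\<lambda>\<zeta>. g \<zeta> * Re (a k * \<zeta> ^ k)) 0" if "k \<in> {1, 2, 3}" for k
      unfolding g_def by (rule planar_normal_density_power_integral[OF \<sigma> that])
    have "has_bochner_integral lborel (\<lambda>\<zeta>. u z * g \<zeta> + g \<zeta> * Re (a 1 * \<zeta> ^ 1) + g \<zeta> * Re (a 2 * \<zeta> ^ 2)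
        + g \<zeta> * Re (a 3 * \<zeta> ^ 3)) (u z * 1 + 0 + 0 + 0)"
      using int by (intro has_bochner_integral_add * has_bochner_integral_mult_right) (auto simp: has_bochner_integral_iff)
    moreover have "g \<zeta> * Re (P \<zeta>) = u z * g \<zeta> + g \<zeta> * Re (a 1 * \<zeta> ^ 1) + g \<zeta> * Re (a 2 * \<zeta> ^ 2)
        + g \<zeta> * Re (a 3 * \<zeta> ^ 3)" for \<zeta>
      by (simp add: P_def numeral_3_eq_3 numeral_2_eq_2 a(1) eq distrib_left del: power_Suc times_complex.sel)
    ultimately show ?thesis by simp
  qed
  \<comment> \<open>The constant is \<open>1024 \<cdot> 8\<close>, as the fourth moment of the norm is \<open>8 \<sigma>\<^sup>4\<close>.\<close>
  have "u z - 8192 * (\<sigma> / \<delta>) ^ 4 = (\<integral>\<zeta>. g \<zeta> * Re (P \<zeta>) - 1024 / \<delta> ^ 4 * (g \<zeta> * norm \<zeta> ^ 4) \<partial>lborel)"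
    using P i4 by (simp add: has_bochner_integral_iff power_divide)
  also have "\<dots> \<le> (\<integral>\<zeta>. g \<zeta> * u (z + \<zeta>) \<partial>lborel)"
  proof (rule integral_mono)
    show "integrable lborel (\<lambda>\<zeta>. g \<zeta> * Re (P \<zeta>) - 1024 / \<delta> ^ 4 * (g \<zeta> * norm \<zeta> ^ 4))"
      using P i4(1) by (intro Bochner_Integration.integrable_diff integrable_mult_right) (auto simp: has_bochner_integral_iff)
    show "integrable lborel (\<lambda>\<zeta>. g \<zeta> * u (z + \<zeta>))"
    proof (rule Bochner_Integration.integrable_bound[OF int(1)])
      show "AE \<zeta> in lborel. norm (g \<zeta> * u (z + \<zeta>)) \<le> norm (g \<zeta>)"
        using u by (auto simp: norm_mult abs_mult intro!: mult_left_le)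
    qed (simp add: g_def)
    show "g \<zeta> * Re (P \<zeta>) - 1024 / \<delta> ^ 4 * (g \<zeta> * norm \<zeta> ^ 4) \<le> g \<zeta> * u (z + \<zeta>)" for \<zeta>
      using mult_left_mono[OF ptw, of "g \<zeta>" \<zeta>] planar_normal_density_nonneg[of \<sigma> \<zeta>]
      by (simp add: g_def algebra_simps)
  qed
  finally show ?thesis by (simp add: g_def)
qed

section \<open>Stopped walks and stopped paths\<close>

text \<open>The walk with start \<open>a\<close> and increments \<open>\<xi>\<close>, frozen when it enters \<open>U\<close>. The recursion involves no
stopping time, so the value after \<open>n\<close> steps depends visibly on the first \<open>n\<close> increments only, and
one step needs only the independence of the current value from the next increment.\<close>

primrec stopped_walk :: "'c::ab_group_add set \<Rightarrow> 'c \<Rightarrow> (nat \<Rightarrow> 'c) \<Rightarrow> nat \<Rightarrow> 'c" where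
  "stopped_walk U a \<xi> 0 = a"
| "stopped_walk U a \<xi> (Suc n) =
     (if stopped_walk U a \<xi> n \<in> U then stopped_walk U a \<xi> n else stopped_walk U a \<xi> n + \<xi> n)"

lemma stopped_walk_increments:
  "\<exists>k\<le>n. stopped_walk U (x 0) (\<lambda>i. x (Suc i) - x i) n = x k \<and> (k = n \<or> x k \<in> U) \<and> (\<forall>j<k. x j \<notin> U)"
proof (induction n)
  case (Suc n)
  then obtain k where k: "k \<le> n" "stopped_walk U (x 0) (\<lambda>i. x (Suc i) - x i) n = x k"
      "k = n \<or> x k \<in> U" "\<forall>j<k. x j \<notin> U" by blast
  show ?case
  proof (cases "x k \<in> U")
    case True
    then show ?thesis using k by (intro exI[of _ k]) auto
  next
    case False
    then show ?thesis using k by (intro exI[of _ "Suc n"]) (auto simp: less_Suc_eq)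
  qed
qed simp

text \<open>Inserting \<open>t\<close> truncates the entrance time into \<open>S\<close>, and keeps the infimum meaningful for a path that
does not enter \<open>S\<close> by time \<open>t\<close>.\<close>

definition stop_time :: "(real \<Rightarrow> 'c) \<Rightarrow> 'c set \<Rightarrow> real \<Rightarrow> real" where
  "stop_time p S t = Inf (insert t {s\<in>{0..t}. p s \<in> S})"

lemma stop_time_bounds:
  assumes "t \<ge> 0" shows "0 \<le> stop_time p S t" "stop_time p S t \<le> t"
proof -
  show "0 \<le> stop_time p S t"
    unfolding stop_time_def using assms by (intro cInf_greatest) auto
  show "stop_time p S t \<le> t"
    unfolding stop_time_def using assms by (intro cInf_lower bdd_belowI[of _ 0]) auto
qed

lemma stop_time_le: "0 \<le> s \<Longrightarrow> s \<le> t \<Longrightarrow> p s \<in> S \<Longrightarrow> stop_time p S t \<le> s"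
  unfolding stop_time_def by (intro cInf_lower bdd_belowI[of _ 0]) auto

lemma stop_time_lessD:
  assumes "stop_time p S t < r" "r \<le> t"
  obtains s where "0 \<le> s" "s < r" "p s \<in> S" "stop_time p S t \<le> s"
proof -
  from assms(1) obtain s where "s \<in> insert t {s\<in>{0..t}. p s \<in> S}" "s < r"
    unfolding stop_time_def by (meson cInf_lessD insert_not_empty)
  then show thesis using assms(2) stop_time_le[of s t p S] by (intro that[of s]) auto
qed

lemma path_continuous_ball:
  fixes p :: "real \<Rightarrow> 'c::metric_space"
  assumes p: "continuous_on {0..} p" and "open U" "0 \<le> s" "p s \<in> U"
  obtains \<eta> where "\<eta> > 0" "\<And>r. 0 \<le> r \<Longrightarrow> \<bar>r - s\<bar> < \<eta> \<Longrightarrow> p r \<in> U"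
proof -
  obtain e where e: "e > 0" "ball (p s) e \<subseteq> U" using assms openE by blast
  then obtain d where "d > 0" "\<forall>r\<in>{0..}. dist r s < d \<longrightarrow> dist (p r) (p s) < e"
    using p \<open>0 \<le> s\<close> unfolding continuous_on_iff by (metis atLeast_iff)
  then show thesis using e by (intro that[of d]) (auto simp: dist_commute dist_real_def)
qed

lemma stop_time_in_closure:
  fixes p :: "real \<Rightarrow> 'c::metric_space"
  assumes p: "continuous_on {0..} p" and "t \<ge> 0" "stop_time p S t < t"
  shows "p (stop_time p S t) \<in> closure S"
proof (rule ccontr)
  let ?\<sigma> = "stop_time p S t"
  assume "p ?\<sigma> \<notin> closure S"
  then have "p ?\<sigma> \<in> - closure S" by simp
  then obtain \<eta> where \<eta>: "\<eta> > 0" "\<And>r. 0 \<le> r \<Longrightarrow> \<bar>r - ?\<sigma>\<bar> < \<eta> \<Longrightarrow> p r \<in> - closure S"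
    using path_continuous_ball[OF p _ stop_time_bounds(1)[OF \<open>t \<ge> 0\<close>], of "- closure S"] by blast
  have "?\<sigma> < min t (?\<sigma> + \<eta>)" using assms(3) \<eta>(1) by simp
  then obtain s where "0 \<le> s" "s < min t (?\<sigma> + \<eta>)" "p s \<in> S" "?\<sigma> \<le> s"
    by (rule stop_time_lessD) auto
  then show False using \<eta>(2)[of s] closure_subset[of S] by auto
qed

text \<open>Openness of \<open>U\<close> is essential: a path may touch a closed set between two grid times, but it spends a whole
time interval in an open set that it enters, so a fine grid notices the entrance.\<close>

lemma stopped_walk_tendsto:
  fixes p :: "real \<Rightarrow> 'c::real_normed_vector"
  assumes p: "continuous_on {0..} p" and t: "t > 0" and U: "open U"
  shows "(\<lambda>N. stopped_walk U (p 0) (\<lambda>i. p (t * real (Suc i) / real (Suc N)) - p (t * real i / real (Suc N))) (Suc N))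
      \<longlonglongrightarrow> p (stop_time p U t)"
proof -
  define g where "g N i = t * real i / real (Suc N)" for N i
  let ?\<sigma> = "stop_time p U t"
  have "\<exists>k\<le>Suc N. stopped_walk U (p 0) (\<lambda>i. p (g N (Suc i)) - p (g N i)) (Suc N) = p (g N k) \<and>
      (k = Suc N \<or> p (g N k) \<in> U) \<and> (\<forall>j<k. p (g N j) \<notin> U)" for N
    using stopped_walk_increments[of "Suc N" U "\<lambda>i. p (g N i)"] by (simp add: g_def del: stopped_walk.simps)
  then obtain k where k: "\<And>N. k N \<le> Suc N"
    "\<And>N. stopped_walk U (p 0) (\<lambda>i. p (g N (Suc i)) - p (g N i)) (Suc N) = p (g N (k N))"
    "\<And>N. k N = Suc N \<or> p (g N (k N)) \<in> U" "\<And>N j. j < k N \<Longrightarrow> p (g N j) \<notin> U"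
    by metis
  define s where "s N = g N (k N)" for N
  have s0: "0 \<le> s N" for N using t by (simp add: s_def g_def)
  have st: "s N \<le> t" for N using t k(1)[of N] by (simp add: s_def g_def divide_le_eq)
  have low: "?\<sigma> \<le> s N" for N
    using k(3)[of N]
  proof
    assume "k N = Suc N"
    then show ?thesis using stop_time_bounds(2)[of t p U] t by (simp add: s_def g_def)
  next
    assume "p (g N (k N)) \<in> U"
    then show ?thesis using s0[of N] st[of N] by (intro stop_time_le) (auto simp: s_def)
  qed
  have "s \<longlonglongrightarrow> ?\<sigma>"
  proof (rule order_tendstoI)
    fix a assume "a < ?\<sigma>"
    then show "\<forall>\<^sub>F N in sequentially. a < s N" using low by (intro always_eventually) (auto intro: less_le_trans)
  next
    fix a assume a: "?\<sigma> < a"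
    show "\<forall>\<^sub>F N in sequentially. s N < a"
    proof (cases "?\<sigma> < t")
      case False
      then show ?thesis using a st by (intro always_eventually) (meson le_less_trans linorder_not_le order.trans)
    next
      case True
      then obtain r where r: "0 \<le> r" "r < min t a" "p r \<in> U"
        using stop_time_lessD[of p U t "min t a"] a by auto
      obtain \<eta> where \<eta>: "\<eta> > 0" "\<And>q. 0 \<le> q \<Longrightarrow> \<bar>q - r\<bar> < \<eta> \<Longrightarrow> p q \<in> U"
        using path_continuous_ball[OF p U r(1,3)] by blast
      define e where "e = min \<eta> (min t a - r)"
      have e: "e > 0" using \<eta> r by (simp add: e_def)
      have "(\<lambda>N. t / real (Suc N)) \<longlonglongrightarrow> 0"
        using tendsto_mult_left[OF LIMSEQ_inverse_real_of_nat, of t] by (simp add: divide_inverse)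
      then have "\<forall>\<^sub>F N in sequentially. t / real (Suc N) < e" using e by (rule order_tendstoD)
      then show ?thesis
      proof eventually_elim
        case (elim N)
        define h where "h = t / real (Suc N)"
        have h: "h > 0" "h < e" using t elim by (auto simp: h_def)
        define j where "j = nat \<lceil>r / h\<rceil>"
        have gj: "g N j = h * real j" by (simp add: g_def h_def)
        have "r / h \<le> real j" "real j < r / h + 1"
          using r(1) h(1) by (auto simp: j_def of_nat_nat ceiling_less_iff) linarith+
        then have "r \<le> g N j" "g N j < r + h"
          unfolding gj using h(1) by (auto simp: field_simps)
        then have gr: "r \<le> g N j" "g N j < r + e" using h by auto
        then have "p (g N j) \<in> U" using r(1) by (intro \<eta>(2)) (auto simp: e_def)
        then have "k N \<le> j" using k(4)[of j N] by (meson linorder_not_less)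
        then have "s N \<le> g N j" using t by (simp add: s_def g_def divide_right_mono)
        also have "\<dots> < a" using gr by (simp add: e_def)
        finally show ?case .
      qed
    qed
  qed
  then have "(\<lambda>N. p (s N)) \<longlonglongrightarrow> p ?\<sigma>"
    using s0 stop_time_bounds(1)[of t p U] t by (intro continuous_on_tendsto_compose[OF p]) auto
  then show ?thesis using k(2) unfolding s_def g_def by simp
qed

text \<open>The truncated entrance times into shrinking neighbourhoods of a closed set increase to a limit,
and at that limit, if it is before \<open>t\<close>, the path has distance 0 from the set by continuity.\<close>

lemma stop_time_shrink_tendsto:
  fixes p :: "real \<Rightarrow> 'c::metric_space"
  assumes p: "continuous_on {0..} p" and t: "t > 0" and K: "closed K" "K \<noteq> {}"
  shows "(\<lambda>m. p (stop_time p {z. infdist z K < 1 / real (Suc m)} t)) \<longlonglongrightarrow> p (stop_time p K t)"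
proof -
  define U where "U m = {z. infdist z K < 1 / real (Suc m)}" for m
  define \<sigma> where "\<sigma> m = stop_time p (U m) t" for m
  have KU: "K \<subseteq> U m" for m by (auto simp: U_def)
  have anti: "U m \<subseteq> U n" if "n \<le> m" for m n
    using that by (auto simp: U_def elim!: order_less_le_trans intro!: divide_left_mono)
  have mono: "stop_time p B t \<le> stop_time p A t" if "A \<subseteq> B" for A B
    unfolding stop_time_def using that t by (intro cInf_superset_mono) (auto intro!: bdd_belowI[of _ 0])
  have inc: "incseq \<sigma>" unfolding \<sigma>_def using anti mono by (auto simp: incseq_def)
  have ub: "\<sigma> m \<le> stop_time p K t" for m unfolding \<sigma>_def using mono KU by blast
  obtain L where L: "\<sigma> \<longlonglongrightarrow> L" "\<And>m. \<sigma> m \<le> L"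
    using incseq_convergent[OF inc] ub by metis
  have L0: "0 \<le> L" using L(2)[of 0] stop_time_bounds(1)[of t p "U 0"] t by (simp add: \<sigma>_def)
  have Lle: "L \<le> stop_time p K t" using L(1) ub by (meson LIMSEQ_le_const2)
  have pL: "(\<lambda>m. p (\<sigma> m)) \<longlonglongrightarrow> p L"
    using L0 t by (intro continuous_on_tendsto_compose[OF p L(1)]) (auto simp: \<sigma>_def stop_time_bounds)
  have "L = stop_time p K t"
  proof (rule ccontr)
    assume "L \<noteq> stop_time p K t"
    with Lle have lt: "L < stop_time p K t" by simp
    then have Lt: "L < t" using stop_time_bounds(2)[of t p K] t by simp
    have "infdist (p (\<sigma> m)) K \<le> 1 / real (Suc m)" for m
    proof -
      have "p (\<sigma> m) \<in> closure (U m)"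
        unfolding \<sigma>_def using Lt L(2)[of m] t by (intro stop_time_in_closure[OF p]) (auto simp: \<sigma>_def)
      moreover have "closure (U m) \<subseteq> {z. infdist z K \<le> 1 / real (Suc m)}"
        by (rule closure_minimal) (auto simp: U_def intro!: closed_Collect_le continuous_intros)
      ultimately show ?thesis by auto
    qed
    moreover have "(\<lambda>m. infdist (p (\<sigma> m)) K) \<longlonglongrightarrow> infdist (p L) K" by (intro tendsto_infdist pL)
    moreover have "(\<lambda>m. 1 / real (Suc m)) \<longlonglongrightarrow> 0"
      using LIMSEQ_inverse_real_of_nat by (simp add: divide_inverse)
    ultimately have "infdist (p L) K \<le> 0" by (meson LIMSEQ_le)
    then have "p L \<in> K" using K by (metis in_closed_iff_infdist_zero infdist_nonneg order_antisym)
    then show False using stop_time_le[of L t p K] L0 Lt lt by simp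
  qed
  then show ?thesis using pL by (simp add: \<sigma>_def U_def)
qed

lemma stop_time_eq:
  assumes "0 \<le> s" "s \<le> t" "p s \<in> S \<or> s = t" "\<And>r. 0 \<le> r \<Longrightarrow> r < s \<Longrightarrow> p r \<notin> S"
  shows "stop_time p S t = s"
  unfolding stop_time_def
proof (rule cInf_eq_minimum)
  show "s \<in> insert t {s \<in> {0..t}. p s \<in> S}" using assms by auto
  show "s \<le> x" if "x \<in> insert t {s \<in> {0..t}. p s \<in> S}" for x
    using that assms(2) assms(4)[of x] by force
qed

lemma hitting_time_finiteE:
  assumes c: "continuous_on {0..} (\<lambda>s. B s \<omega>)" and K: "closed K"
    and fin: "hitting_time B K \<omega> < \<infinity>"
  obtains s where "0 \<le> s" "hitting_point B K \<omega> = B s \<omega>" "B s \<omega> \<in> K"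
    "\<And>t. s \<le> t \<Longrightarrow> stop_time (\<lambda>s. B s \<omega>) K t = s"
proof -
  let ?p = "\<lambda>s. B s \<omega>"
  obtain r where r: "0 \<le> r" "?p r \<in> K"
    using fin unfolding hitting_time_def INF_less_iff by auto
  define s where "s = stop_time ?p K r"
  have s: "0 \<le> s" "s \<le> r" using stop_time_bounds[OF r(1), of ?p K] by (auto simp: s_def)
  have sK: "?p s \<in> K"
  proof (cases "s < r")
    case True
    then show ?thesis using stop_time_in_closure[OF c r(1), of K] K by (simp add: s_def)
  qed (use s r in auto)
  have before: "?p q \<notin> K" if "0 \<le> q" "q < s" for q
    using stop_time_le[of q r ?p K] that s by (auto simp: s_def)
  have ht: "hitting_time B K \<omega> = ereal s"
    unfolding hitting_time_def
  proof (rule antisym)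
    show "(INF t\<in>{t. 0 \<le> t \<and> B t \<omega> \<in> K}. ereal t) \<le> ereal s" using s sK by (intro INF_lower) auto
    show "ereal s \<le> (INF t\<in>{t. 0 \<le> t \<and> B t \<omega> \<in> K}. ereal t)"
      using before by (intro INF_greatest) (force simp: not_less[symmetric])
  qed
  show thesis
  proof
    show "stop_time ?p K t = s" if "s \<le> t" for t
      using that s sK before by (intro stop_time_eq) auto
  qed (use s sK ht in \<open>auto simp: hitting_point_def\<close>)
qed

lemma stop_time_hitting_time_infinite:
  assumes "\<not> hitting_time B K \<omega> < \<infinity>"
  shows "0 \<le> s \<Longrightarrow> B s \<omega> \<notin> K" and "0 \<le> t \<Longrightarrow> stop_time (\<lambda>s. B s \<omega>) K t = t"
proof -
  show *: "B s \<omega> \<notin> K" if "0 \<le> s" for s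
    using assms that unfolding hitting_time_def INF_less_iff by auto
  show "stop_time (\<lambda>s. B s \<omega>) K t = t" if "0 \<le> t"
    using that * by (intro stop_time_eq) auto
qed

section \<open>Optional stopping for planar Brownian motion\<close>

lemma stopped_walk_cong:
  "(\<And>i. i < n \<Longrightarrow> \<xi> i = \<xi>' i) \<Longrightarrow> stopped_walk U a \<xi> n = stopped_walk U a \<xi>' n"
  by (induction n) auto

lemma measurable_stopped_walk:
  fixes \<xi> :: "nat \<Rightarrow> 'b \<Rightarrow> complex"
  assumes [measurable]: "U \<in> sets borel" "A \<in> borel_measurable M"
    and \<xi>: "\<And>i. i < n \<Longrightarrow> \<xi> i \<in> borel_measurable M"
  shows "(\<lambda>\<omega>. stopped_walk U (A \<omega>) (\<lambda>i. \<xi> i \<omega>) n) \<in> borel_measurable M"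
  using \<xi>
proof (induction n)
  case (Suc n)
  then have [measurable]: "(\<lambda>\<omega>. stopped_walk U (A \<omega>) (\<lambda>i. \<xi> i \<omega>) n) \<in> borel_measurable M"
    "\<xi> n \<in> borel_measurable M" by auto
  show ?case by simp
qed simp

text \<open>A form of subharmonicity off \<open>K\<close> that asks for explicit minorants. Real parts of holomorphic functions
bounded by 1 satisfy it, and so do moduli of multivalued ones, which have branches on discs.\<close>

definition holomorphically_supported_off :: "complex set \<Rightarrow> (complex \<Rightarrow> real) \<Rightarrow> bool" where
  "holomorphically_supported_off K u \<longleftrightarrow>
     (\<forall>z \<delta>. \<delta> > 0 \<longrightarrow> ball z \<delta> \<inter> K = {} \<longrightarrow>
        (\<exists>F. F holomorphic_on ball z \<delta> \<and> Re (F z) = u z \<and>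
             (\<forall>y\<in>ball z \<delta>. norm (F y) \<le> 1 \<and> Re (F y) \<le> u y)))"

context planar_brownian_motion
begin

lemma increment_distributed:
  assumes "0 \<le> s" "s < t"
  shows "distributed M lborel (\<lambda>\<omega>. B t \<omega> - B s \<omega>) (\<lambda>z. ennreal (planar_normal_density (sqrt (t - s)) z))"
  using B_normal_increments[OF assms] by (simp add: planar_normal_density_def)

text \<open>Given the current value \<open>S\<close>, which is independent of the next increment, the expected value of \<open>u\<close>
after the step is at least \<open>u S\<close> up to an error of order \<open>h\<^sup>2\<close>: the walk either is frozen, or is at
distance at least \<open>\<delta>\<close> from \<open>K\<close>, where the sub-mean value inequality applies.\<close>

lemma stopped_walk_step:
  fixes u :: "complex \<Rightarrow> real"
  assumes t: "t > 0" and n: "n < m" and h: "h = t / real m"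
    and u[measurable]: "u \<in> borel_measurable borel" and u1: "\<And>y. \<bar>u y\<bar> \<le> 1"
    and sup: "holomorphically_supported_off K u" and K: "K \<noteq> {}"
    and \<delta>: "\<delta> > 0" and U: "U = {z. infdist z K < \<delta>}"
  defines "\<xi> \<equiv> \<lambda>i \<omega>. B (t * real (Suc i) / real m) \<omega> - B (t * real i / real m) \<omega>"
  shows "expectation (\<lambda>\<omega>. u (stopped_walk U b (\<lambda>i. \<xi> i \<omega>) (Suc n))) \<ge>
     expectation (\<lambda>\<omega>. u (stopped_walk U b (\<lambda>i. \<xi> i \<omega>) n)) - 8192 * h\<^sup>2 / \<delta> ^ 4"
proof -
  define S where "S = (\<lambda>\<omega>. stopped_walk U b (\<lambda>i. \<xi> i \<omega>) n)"
  have Um[measurable]: "U \<in> sets borel"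
    unfolding U by (intro borel_open open_Collect_less continuous_intros)
  have \<xi>m: "\<xi> i \<in> borel_measurable M" for i
    unfolding \<xi>_def using t by (intro borel_measurable_diff B_measurable) auto
  have Sm[measurable]: "S \<in> borel_measurable M"
    unfolding S_def using measurable_stopped_walk[of U "\<lambda>_. b" M n \<xi>] \<xi>m by simp
  note \<xi>m[of n, measurable]
  have ind: "indep_vars (\<lambda>_. borel) \<xi> {..<m}"
    unfolding \<xi>_def using t
    by (intro B_indep_increments) (auto intro!: divide_right_mono mult_left_mono)
  have "indep_var (PiM {..<n} (\<lambda>_. borel)) (\<lambda>\<omega>. restrict (\<lambda>i. \<xi> i \<omega>) {..<n})
      (PiM {n} (\<lambda>_. borel)) (\<lambda>\<omega>. restrict (\<lambda>i. \<xi> i \<omega>) {n})"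
    using n by (intro indep_var_restrict[OF ind]) auto
  moreover have "(\<lambda>f. stopped_walk U b f n) \<in> borel_measurable (PiM {..<n} (\<lambda>_. borel))"
    using measurable_stopped_walk[of U "\<lambda>_. b" "PiM {..<n} (\<lambda>_. borel)" n "\<lambda>i f. f i"] Um by simp
  moreover have "(\<lambda>f. f n) \<in> borel_measurable (PiM {n} (\<lambda>_. borel :: complex measure))" by simp
  ultimately have "indep_var borel ((\<lambda>f. stopped_walk U b f n) \<circ> (\<lambda>\<omega>. restrict (\<lambda>i. \<xi> i \<omega>) {..<n}))
      borel ((\<lambda>f. f n) \<circ> (\<lambda>\<omega>. restrict (\<lambda>i. \<xi> i \<omega>) {n}))"
    by (rule indep_var_compose)
  moreover have "(\<lambda>f. stopped_walk U b f n) \<circ> (\<lambda>\<omega>. restrict (\<lambda>i. \<xi> i \<omega>) {..<n}) = S"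
    by (auto simp: S_def fun_eq_iff intro!: stopped_walk_cong)
  moreover have "(\<lambda>f. f n) \<circ> (\<lambda>\<omega>. restrict (\<lambda>i. \<xi> i \<omega>) {n}) = \<xi> n"
    by (auto simp: fun_eq_iff)
  ultimately have iv: "indep_var borel S borel (\<xi> n)" by simp
  define \<mu> \<nu> where "\<mu> = distr M borel S" and "\<nu> = distr M borel (\<xi> n)"
  have prod: "\<mu> \<Otimes>\<^sub>M \<nu> = distr M (borel \<Otimes>\<^sub>M borel) (\<lambda>\<omega>. (S \<omega>, \<xi> n \<omega>))"
    using iv unfolding indep_var_distribution_eq \<mu>_def \<nu>_def by blast
  interpret \<mu>: prob_space \<mu> unfolding \<mu>_def by (rule prob_space_distr) simp
  interpret \<nu>: prob_space \<nu> unfolding \<nu>_def by (rule prob_space_distr) simp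
  interpret \<mu>\<nu>: pair_prob_space \<mu> \<nu> ..
  have sets[measurable_cong]: "sets \<mu> = sets borel" "sets \<nu> = sets borel" by (auto simp: \<mu>_def \<nu>_def)
  define \<psi> where "\<psi> = (\<lambda>(z, y). u (if z \<in> U then z else z + y))"
  have \<psi>m: "\<psi> \<in> borel_measurable (borel \<Otimes>\<^sub>M borel)" unfolding \<psi>_def by measurable
  have int: "integrable (\<mu> \<Otimes>\<^sub>M \<nu>) \<psi>"
    using \<psi>m u1 by (intro \<mu>\<nu>.P.integrable_const_bound[where B = 1])
      (auto simp: \<psi>_def measurable_cong_sets[OF sets_pair_measure_cong[OF sets] refl])
  have hpos: "h > 0" using t n h by simp
  have dist: "distributed M lborel (\<xi> n) (\<lambda>z. ennreal (planar_normal_density (sqrt h) z))"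
  proof -
    have "t * real (Suc n) / real m - t * real n / real m = h"
      unfolding h by (simp add: algebra_simps add_divide_distrib)
    moreover have "t * real n / real m < t * real (Suc n) / real m"
      using t n by (simp add: divide_strict_right_mono)
    ultimately show ?thesis
      using increment_distributed[of "t * real n / real m" "t * real (Suc n) / real m"] t
      by (simp add: \<xi>_def)
  qed
  have \<nu>: "\<nu> = density lborel (\<lambda>z. ennreal (planar_normal_density (sqrt h) z))"
    using dist unfolding \<nu>_def distributed_def by (simp cong: distr_cong)
  have inner: "(\<integral>y. \<psi> (z, y) \<partial>\<nu>) \<ge> u z - 8192 * h\<^sup>2 / \<delta> ^ 4" for z
  proof (cases "z \<in> U")
    case True
    then show ?thesis using \<delta> by (simp add: \<psi>_def \<nu>.prob_space)
  next
    case False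
    have "ball z \<delta> \<inter> K = {}"
    proof -
      have "y \<notin> ball z \<delta>" if "y \<in> K" for y
        using infdist_le[OF that, of z] False by (simp add: U)
      then show ?thesis by auto
    qed
    then obtain F where F: "F holomorphic_on ball z \<delta>" "Re (F z) = u z"
       "\<And>y. y \<in> ball z \<delta> \<Longrightarrow> norm (F y) \<le> 1" "\<And>y. y \<in> ball z \<delta> \<Longrightarrow> Re (F y) \<le> u y"
      using sup \<delta> unfolding holomorphically_supported_off_def by blast
    have "u z - 8192 * (sqrt h / \<delta>) ^ 4 \<le> (\<integral>\<zeta>. planar_normal_density (sqrt h) \<zeta> * u (z + \<zeta>) \<partial>lborel)"
      using hpos \<delta> u1 F by (intro planar_normal_submean) auto
    also have "\<dots> = (\<integral>y. \<psi> (z, y) \<partial>\<nu>)"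
      unfolding \<nu> using False
      by (subst integral_real_density) (auto simp: \<psi>_def planar_normal_density_nonneg)
    also have "(sqrt h / \<delta>) ^ 4 = h\<^sup>2 / \<delta> ^ 4"
    proof -
      have "sqrt h ^ 4 = (sqrt h ^ 2) ^ 2" by (simp flip: power_mult)
      then show ?thesis using hpos by (simp add: power_divide)
    qed
    finally show ?thesis by simp
  qed
  have intu: "integrable \<mu> u" using u1 by (intro \<mu>.integrable_const_bound[where B = 1]) auto
  have "expectation (\<lambda>\<omega>. u (stopped_walk U b (\<lambda>i. \<xi> i \<omega>) (Suc n))) = expectation (\<lambda>\<omega>. \<psi> (S \<omega>, \<xi> n \<omega>))"
    by (intro Bochner_Integration.integral_cong refl) (simp add: \<psi>_def S_def)
  also have "\<dots> = integral\<^sup>L (\<mu> \<Otimes>\<^sub>M \<nu>) \<psi>"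
    unfolding prod using \<psi>m by (subst integral_distr) auto
  also have "\<dots> = (\<integral>z. \<integral>y. \<psi> (z, y) \<partial>\<nu> \<partial>\<mu>)" using \<mu>\<nu>.integral_fst'[OF int] by simp
  also have "\<dots> \<ge> (\<integral>z. u z - 8192 * h\<^sup>2 / \<delta> ^ 4 \<partial>\<mu>)"
  proof (rule integral_mono)
    show "integrable \<mu> (\<lambda>z. u z - 8192 * h\<^sup>2 / \<delta> ^ 4)"
      using intu by simp
    show "integrable \<mu> (\<lambda>z. \<integral>y. \<psi> (z, y) \<partial>\<nu>)" by (rule \<mu>\<nu>.integrable_fst'[OF int])
  qed (rule inner)
  also have "(\<integral>z. u z - 8192 * h\<^sup>2 / \<delta> ^ 4 \<partial>\<mu>) = (\<integral>z. u z \<partial>\<mu>) - 8192 * h\<^sup>2 / \<delta> ^ 4"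
    using intu by (simp add: \<mu>.prob_space)
  also have "(\<integral>z. u z \<partial>\<mu>) = expectation (\<lambda>\<omega>. u (S \<omega>))"
    unfolding \<mu>_def by (subst integral_distr) auto
  finally show ?thesis by (simp add: S_def)
qed

lemma stopped_walk_path_measurable:
  assumes "U \<in> sets borel" "t > 0"
  shows "(\<lambda>\<omega>. stopped_walk U (B 0 \<omega>) (\<lambda>i. B (t * real (Suc i) / real m) \<omega> - B (t * real i / real m) \<omega>) n)
      \<in> borel_measurable M"
  using assms by (intro measurable_stopped_walk borel_measurable_diff B_measurable) auto

lemma stopped_open_measurable:
  assumes "open U" "t > 0"
  shows "(\<lambda>\<omega>. B (stop_time (\<lambda>s. B s \<omega>) U t) \<omega>) \<in> borel_measurable M"
proof (rule borel_measurable_LIMSEQ_metric)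
  show "(\<lambda>\<omega>. stopped_walk U (B 0 \<omega>) (\<lambda>i. B (t * real (Suc i) / real (Suc N)) \<omega> - B (t * real i / real (Suc N)) \<omega>) (Suc N))
      \<in> borel_measurable M" for N
    using assms by (intro stopped_walk_path_measurable) auto
  show "(\<lambda>N. stopped_walk U (B 0 \<omega>) (\<lambda>i. B (t * real (Suc i) / real (Suc N)) \<omega> - B (t * real i / real (Suc N)) \<omega>) (Suc N))
      \<longlonglongrightarrow> B (stop_time (\<lambda>s. B s \<omega>) U t) \<omega>" if "\<omega> \<in> space M" for \<omega>
    using stopped_walk_tendsto[OF B_continuous[OF that] assms(2,1)] .
qed

lemma open_infdist_less: "open {z. infdist z K < e}"
  by (intro open_Collect_less continuous_intros)

lemma stopped_closed_measurable:
  assumes "closed K" "K \<noteq> {}" "t > 0"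
  shows "(\<lambda>\<omega>. B (stop_time (\<lambda>s. B s \<omega>) K t) \<omega>) \<in> borel_measurable M"
proof (rule borel_measurable_LIMSEQ_metric)
  show "(\<lambda>\<omega>. B (stop_time (\<lambda>s. B s \<omega>) {z. infdist z K < 1 / real (Suc m)} t) \<omega>) \<in> borel_measurable M" for m
    using assms by (intro stopped_open_measurable open_infdist_less)
  show "(\<lambda>m. B (stop_time (\<lambda>s. B s \<omega>) {z. infdist z K < 1 / real (Suc m)} t) \<omega>)
      \<longlonglongrightarrow> B (stop_time (\<lambda>s. B s \<omega>) K t) \<omega>" if "\<omega> \<in> space M" for \<omega>
    using stop_time_shrink_tendsto[OF B_continuous[OF that] assms(3,1,2)] .
qed

text \<open>Optional stopping for subharmonic functions. With \<open>N + 1\<close> steps of length \<open>t / (N + 1)\<close> and the walk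
frozen at distance \<open>\<delta>\<close> from \<open>K\<close>, the errors add up to a multiple of \<open>t\<^sup>2 / ((N + 1) \<delta>\<^sup>4)\<close>. So first the
mesh tends to 0 for fixed \<open>\<delta>\<close>, then the neighbourhood shrinks to \<open>K\<close>; both limits are taken
along each path and pass through the expectation by boundedness and continuity of \<open>u\<close>.\<close>

lemma stopped_expectation_ge:
  fixes u :: "complex \<Rightarrow> real"
  assumes K: "closed K" "K \<noteq> {}" and t: "t > 0"
    and cont: "continuous_on UNIV u" and u1: "\<And>y. \<bar>u y\<bar> \<le> 1"
    and sup: "holomorphically_supported_off K u"
  shows "expectation (\<lambda>\<omega>. u (B (stop_time (\<lambda>s. B s \<omega>) K t) \<omega>)) \<ge> u b"
proof -
  have um[measurable]: "u \<in> borel_measurable borel" using cont by (rule borel_measurable_continuous_onI)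
  have ucont: "isCont u z" for z using cont by (simp add: continuous_on_eq_continuous_at)
  have open_ge: "expectation (\<lambda>\<omega>. u (B (stop_time (\<lambda>s. B s \<omega>) {z. infdist z K < \<delta>} t) \<omega>)) \<ge> u b"
    if \<delta>: "\<delta> > 0" for \<delta>
  proof -
    define U where "U = {z. infdist z K < \<delta>}"
    have U: "open U" unfolding U_def by (rule open_infdist_less)
    then have Um[measurable]: "U \<in> sets borel" by simp
    define \<xi> where "\<xi> N i \<omega> = B (t * real (Suc i) / real (Suc N)) \<omega> - B (t * real i / real (Suc N)) \<omega>" for N i \<omega>
    define W where "W N \<omega> = stopped_walk U (B 0 \<omega>) (\<lambda>i. \<xi> N i \<omega>) (Suc N)" for N \<omega>
    define c where "c N = 8192 * (t / real (Suc N))\<^sup>2 / \<delta> ^ 4" for N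
    have ge: "expectation (\<lambda>\<omega>. u (stopped_walk U b (\<lambda>i. \<xi> N i \<omega>) n)) \<ge> u b - real n * c N"
      if "n \<le> Suc N" for n N
      using that
    proof (induction n)
      case 0
      then show ?case by (simp add: prob_space)
    next
      case (Suc n)
      have "expectation (\<lambda>\<omega>. u (stopped_walk U b (\<lambda>i. \<xi> N i \<omega>) (Suc n))) \<ge>
          expectation (\<lambda>\<omega>. u (stopped_walk U b (\<lambda>i. \<xi> N i \<omega>) n)) - c N"
        unfolding c_def \<xi>_def using Suc.prems
        by (intro stopped_walk_step[OF t _ refl um u1 sup K(2) \<delta> U_def]) simp
      then show ?case using Suc by (simp add: algebra_simps)
    qed
    have W_eq: "expectation (\<lambda>\<omega>. u (W N \<omega>)) = expectation (\<lambda>\<omega>. u (stopped_walk U b (\<lambda>i. \<xi> N i \<omega>) (Suc N)))" for N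
    proof (rule integral_cong_AE)
      show "AE \<omega> in M. u (W N \<omega>) = u (stopped_walk U b (\<lambda>i. \<xi> N i \<omega>) (Suc N))"
        using B_start by eventually_elim (simp add: W_def del: stopped_walk.simps)
      show "(\<lambda>\<omega>. u (W N \<omega>)) \<in> borel_measurable M"
        unfolding W_def \<xi>_def using t
        by (intro measurable_compose[OF stopped_walk_path_measurable um]) auto
      show "(\<lambda>\<omega>. u (stopped_walk U b (\<lambda>i. \<xi> N i \<omega>) (Suc N))) \<in> borel_measurable M"
        unfolding \<xi>_def using t
        by (intro measurable_compose[OF measurable_stopped_walk um] borel_measurable_diff B_measurable) auto
    qed
    have "(\<lambda>N. expectation (\<lambda>\<omega>. u (W N \<omega>))) \<longlonglongrightarrow>
        expectation (\<lambda>\<omega>. u (B (stop_time (\<lambda>s. B s \<omega>) U t) \<omega>))"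
    proof (rule integral_dominated_convergence)
      show "(\<lambda>\<omega>. u (B (stop_time (\<lambda>s. B s \<omega>) U t) \<omega>)) \<in> borel_measurable M"
        by (intro measurable_compose[OF stopped_open_measurable um] U t)
      show "(\<lambda>\<omega>. u (W N \<omega>)) \<in> borel_measurable M" for N
        unfolding W_def \<xi>_def using t
        by (intro measurable_compose[OF stopped_walk_path_measurable um]) auto
      show "integrable M (\<lambda>_. 1::real)" by simp
      show "AE \<omega> in M. (\<lambda>N. u (W N \<omega>)) \<longlonglongrightarrow> u (B (stop_time (\<lambda>s. B s \<omega>) U t) \<omega>)"
        unfolding W_def \<xi>_def
        by (intro AE_I2 isCont_tendsto_compose[OF ucont] stopped_walk_tendsto B_continuous t U)
      show "AE \<omega> in M. norm (u (W N \<omega>)) \<le> 1" for N using u1 by simp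
    qed
    moreover have "(\<lambda>N. u b - real (Suc N) * c N) \<longlonglongrightarrow> u b - 8192 * t\<^sup>2 / \<delta> ^ 4 * 0"
    proof -
      have "(\<lambda>N. u b - 8192 * t\<^sup>2 / \<delta> ^ 4 * inverse (real (Suc N))) \<longlonglongrightarrow> u b - 8192 * t\<^sup>2 / \<delta> ^ 4 * 0"
        by (intro tendsto_intros LIMSEQ_inverse_real_of_nat)
      moreover have "real (Suc N) * c N = 8192 * t\<^sup>2 / \<delta> ^ 4 * inverse (real (Suc N))" for N
        by (simp add: c_def power_divide power2_eq_square field_simps del: of_nat_Suc)
      ultimately show ?thesis by simp
    qed
    ultimately show ?thesis
      using ge[of "Suc N" N for N] unfolding U_def[symmetric] W_eq[symmetric]
      by (intro LIMSEQ_le[of "\<lambda>N. u b - real (Suc N) * c N" "u b"]) (auto simp: W_eq)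
  qed
  have "(\<lambda>m. expectation (\<lambda>\<omega>. u (B (stop_time (\<lambda>s. B s \<omega>) {z. infdist z K < 1 / real (Suc m)} t) \<omega>)))
      \<longlonglongrightarrow> expectation (\<lambda>\<omega>. u (B (stop_time (\<lambda>s. B s \<omega>) K t) \<omega>))"
  proof (rule integral_dominated_convergence)
    show "(\<lambda>\<omega>. u (B (stop_time (\<lambda>s. B s \<omega>) K t) \<omega>)) \<in> borel_measurable M"
      by (intro measurable_compose[OF stopped_closed_measurable um] K t)
    show "(\<lambda>\<omega>. u (B (stop_time (\<lambda>s. B s \<omega>) {z. infdist z K < 1 / real (Suc m)} t) \<omega>)) \<in> borel_measurable M" for m
      by (intro measurable_compose[OF stopped_open_measurable um] open_infdist_less t)
    show "integrable M (\<lambda>_. 1::real)" by simp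
    show "AE \<omega> in M. (\<lambda>m. u (B (stop_time (\<lambda>s. B s \<omega>) {z. infdist z K < 1 / real (Suc m)} t) \<omega>))
        \<longlonglongrightarrow> u (B (stop_time (\<lambda>s. B s \<omega>) K t) \<omega>)"
      by (intro AE_I2 isCont_tendsto_compose[OF ucont] stop_time_shrink_tendsto B_continuous t K)
    show "AE \<omega> in M. norm (u (B (stop_time (\<lambda>s. B s \<omega>) {z. infdist z K < 1 / real (Suc m)} t) \<omega>)) \<le> 1" for m
      using u1 by simp
  qed
  then show ?thesis by (rule LIMSEQ_le_const) (auto intro!: exI[of _ 0] open_ge)
qed

end

section \<open>Hitting the slit\<close>

abbreviation slit :: "complex set" where "slit \<equiv> closed_segment (-1) 1"

text \<open>The unit factor \<open>c\<close> is there to cover both signs: applied to \<open>c = 1\<close> and \<open>c = -1\<close>, optional stopping gives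
an equality.\<close>

lemma joukowski_inv_supported:
  assumes "norm c = 1"
  shows "holomorphically_supported_off slit (\<lambda>z. Re (c * joukowski_inv z ^ n))"
  unfolding holomorphically_supported_off_def
proof (intro allI impI)
  fix z :: complex and \<delta> :: real assume "ball z \<delta> \<inter> slit = {}"
  then have "ball z \<delta> \<subseteq> - slit" by auto
  then have "(\<lambda>z. c * joukowski_inv z ^ n) holomorphic_on ball z \<delta>"
    by (intro holomorphic_intros holomorphic_on_subset[OF holomorphic_joukowski_inv])
  moreover have "norm (c * joukowski_inv y ^ n) \<le> 1" for y
    using assms norm_joukowski_inv_le_1[of y] by (simp add: norm_mult norm_power power_le_one)
  ultimately show "\<exists>F. F holomorphic_on ball z \<delta> \<and> Re (F z) = Re (c * joukowski_inv z ^ n) \<and>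
      (\<forall>y\<in>ball z \<delta>. norm (F y) \<le> 1 \<and> Re (F y) \<le> Re (c * joukowski_inv y ^ n))" by blast
qed

text \<open>The modulus of the multivalued function \<open>w powr s\<close>. On a disc off the slit a branch exists, and a
unimodular factor makes it real and positive at the centre, where its real part then touches its modulus.\<close>

lemma norm_joukowski_inv_powr_supported:
  assumes "s > 0"
  shows "holomorphically_supported_off slit (\<lambda>z. norm (joukowski_inv z) powr s)"
  unfolding holomorphically_supported_off_def
proof (intro allI impI)
  fix z :: complex and \<delta> :: real assume \<delta>: "\<delta> > 0" and disj: "ball z \<delta> \<inter> slit = {}"
  have hol: "joukowski_inv holomorphic_on ball z \<delta>"
    using disj by (intro holomorphic_on_subset[OF holomorphic_joukowski_inv]) auto
  obtain g where g: "g holomorphic_on ball z \<delta>" "\<And>y. y \<in> ball z \<delta> \<Longrightarrow> exp (g y) = joukowski_inv y"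
    using holomorphic_logarithm_exists[OF convex_ball open_ball hol joukowski_inv_nonzero, of z] \<delta> by auto
  define F where "F y = exp (of_real s * g y - \<i> * of_real (s * Im (g z)))" for y
  have norm_F: "norm (F y) = norm (joukowski_inv y) powr s" if "y \<in> ball z \<delta>" for y
    unfolding g(2)[OF that, symmetric] F_def by (simp add: powr_def)
  have "F holomorphic_on ball z \<delta>" unfolding F_def by (intro holomorphic_intros g)
  moreover have "Re (F z) = norm (joukowski_inv z) powr s"
    using norm_F[of z] \<delta> by (simp add: F_def Re_exp)
  moreover have "norm (F y) \<le> 1 \<and> Re (F y) \<le> norm (joukowski_inv y) powr s" if "y \<in> ball z \<delta>" for y
    using norm_F[OF that] complex_Re_le_cmod[of "F y"] norm_joukowski_inv_le_1[of y] assms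
      powr_mono_both'[of s s "norm (joukowski_inv y)" 1] powr_mono2[of s "norm (joukowski_inv y)" 1] by auto
  ultimately show "\<exists>F. F holomorphic_on ball z \<delta> \<and> Re (F z) = norm (joukowski_inv z) powr s \<and>
      (\<forall>y\<in>ball z \<delta>. norm (F y) \<le> 1 \<and> Re (F y) \<le> norm (joukowski_inv y) powr s)" by blast
qed

lemma norm_joukowski_inv_small:
  assumes "\<epsilon> > 0" "norm z \<ge> 1 / \<epsilon> + 1"
  shows "norm (joukowski_inv z) \<le> \<epsilon>"
proof -
  define a where "a = norm (joukowski_inv z)"
  have a: "0 < a" "a \<le> 1" by (auto simp: a_def joukowski_inv_nonzero norm_joukowski_inv_le_1)
  have "2 * norm z = norm ((z - 1) + (z + 1))" by (simp flip: mult_2 add: norm_mult)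
  also have "\<dots> \<le> norm (z - 1) + norm (z + 1)" by (rule norm_triangle_ineq)
  also have "\<dots> = a + 1 / a" by (simp add: a_def norm_joukowski_inv_ellipse)
  finally have "2 * norm z \<le> a + 1 / a" .
  moreover have "1 / \<epsilon> > 0" using assms(1) by simp
  ultimately have "1 / a \<ge> 1 / \<epsilon>" using a(2) assms(2) by linarith
  then show ?thesis using a assms by (simp add: a_def[symmetric] field_simps)
qed

context planar_brownian_motion
begin

abbreviation stopped :: "real \<Rightarrow> 'a \<Rightarrow> complex" where
  "stopped t \<omega> \<equiv> B (stop_time (\<lambda>s. B s \<omega>) slit t) \<omega>"

abbreviation hits :: "'a set" where
  "hits \<equiv> {\<omega>\<in>space M. hitting_time B slit \<omega> < \<infinity>}"

lemma stopped_measurable [measurable]: "t > 0 \<Longrightarrow> stopped t \<in> borel_measurable M"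
  by (intro stopped_closed_measurable closed_segment) auto

lemma hits_finiteE:
  assumes "\<omega> \<in> hits"
  obtains s where "0 \<le> s" "hitting_point B slit \<omega> = B s \<omega>" "B s \<omega> \<in> slit"
    "\<And>t. s \<le> t \<Longrightarrow> stop_time (\<lambda>s. B s \<omega>) slit t = s"
proof -
  have \<omega>: "\<omega> \<in> space M" "hitting_time B slit \<omega> < \<infinity>" using assms by auto
  show thesis by (rule hitting_time_finiteE[OF B_continuous[OF \<omega>(1)] closed_segment \<omega>(2)]) (rule that)
qed

text \<open>Measurability of the event of hitting is read off the stopped values: the path has hit the slit
by time \<open>t\<close> exactly if its stopped value at \<open>t\<close> lies on the slit.\<close>

lemma hits_eq: "hits = {\<omega>\<in>space M. \<exists>n. stopped (real (Suc n)) \<omega> \<in> slit}"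
proof (intro set_eqI iffI)
  fix \<omega> assume h: "\<omega> \<in> hits"
  then obtain s where s: "B s \<omega> \<in> slit" "\<And>t. s \<le> t \<Longrightarrow> stop_time (\<lambda>s. B s \<omega>) slit t = s"
    using hits_finiteE by metis
  obtain n where "s \<le> real n" using real_arch_simple by blast
  then have "stopped (real (Suc n)) \<omega> \<in> slit" using s by auto
  then show "\<omega> \<in> {\<omega>\<in>space M. \<exists>n. stopped (real (Suc n)) \<omega> \<in> slit}" using h by auto
next
  fix \<omega> assume "\<omega> \<in> {\<omega>\<in>space M. \<exists>n. stopped (real (Suc n)) \<omega> \<in> slit}"
  then obtain n where "\<omega> \<in> space M" "stopped (real (Suc n)) \<omega> \<in> slit" by auto
  then show "\<omega> \<in> hits"
    using stop_time_hitting_time_infinite(1)[of B slit \<omega>] stop_time_bounds(1)[of "real (Suc n)"] by auto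
qed

lemma hits_measurable [measurable]: "hits \<in> sets M"
proof -
  have [measurable]: "slit \<in> sets borel" by (intro borel_closed closed_segment)
  have [measurable]: "stopped (real (Suc n)) \<in> borel_measurable M" for n by simp
  show ?thesis unfolding hits_eq by measurable
qed

lemma stopped_tendsto_hitting_point:
  assumes "\<omega> \<in> hits"
  shows "(\<lambda>n. stopped (real (Suc n)) \<omega>) \<longlonglongrightarrow> hitting_point B slit \<omega>"
proof -
  obtain s where s: "hitting_point B slit \<omega> = B s \<omega>" "\<And>t. s \<le> t \<Longrightarrow> stop_time (\<lambda>s. B s \<omega>) slit t = s"
    using hits_finiteE[OF assms] by metis
  obtain n where "s \<le> real n" using real_arch_simple by blast
  then have "\<forall>\<^sub>F m in sequentially. stopped (real (Suc m)) \<omega> = hitting_point B slit \<omega>"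
    using s by (intro eventually_sequentiallyI[of n]) (auto simp: s)
  then show ?thesis by (rule tendsto_eventually)
qed

lemma hitting_point_measurable [measurable]: "hitting_point B slit \<in> borel_measurable M"
proof (rule borel_measurable_LIMSEQ_metric)
  have [measurable]: "stopped (real (Suc n)) \<in> borel_measurable M" "B 0 \<in> borel_measurable M" for n
    by (simp_all add: B_measurable)
  show "(\<lambda>\<omega>. if \<omega> \<in> hits then stopped (real (Suc n)) \<omega> else B 0 \<omega>) \<in> borel_measurable M" for n
    by measurable
  show "(\<lambda>n. if \<omega> \<in> hits then stopped (real (Suc n)) \<omega> else B 0 \<omega>) \<longlonglongrightarrow> hitting_point B slit \<omega>"
    if "\<omega> \<in> space M" for \<omega>
  proof (cases "\<omega> \<in> hits")
    case False
    then have "hitting_time B slit \<omega> = \<infinity>" using that by auto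
    then show ?thesis using False by (simp add: hitting_point_def)
  qed (use stopped_tendsto_hitting_point in auto)
qed

text \<open>The density of the increment over a time \<open>t\<close> is at most \<open>1 / (2 \<pi> t)\<close>, so it gives a disc of fixed
radius a vanishing probability.\<close>

lemma prob_in_ball_tendsto_0: "(\<lambda>n. prob {\<omega>\<in>space M. norm (B (real (Suc n)) \<omega>) \<le> R}) \<longlonglongrightarrow> 0"
proof -
  define C where "C = measure lborel (cball (0::complex) (R + norm b))"
  have bound: "prob {\<omega>\<in>space M. norm (B (real (Suc n)) \<omega>) \<le> R} \<le> C / (2 * pi) * inverse (real (Suc n))" for n
  proof -
    define t where "t = real (Suc n)"
    have t: "t > 0" by (simp add: t_def)
    define A where "A = cball (0::complex) (R + norm b)"
    have Am[measurable]: "A \<in> sets borel" unfolding A_def by simp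
    have [measurable]: "B t \<in> borel_measurable M" "B 0 \<in> borel_measurable M" using t by (auto intro: B_measurable)
    have d: "distributed M lborel (\<lambda>\<omega>. B t \<omega> - B 0 \<omega>) (\<lambda>z. ennreal (planar_normal_density (sqrt t) z))"
      using increment_distributed[of 0 t] t by simp
    have "norm (B t \<omega> - B 0 \<omega>) \<le> R + norm b" if "norm (B t \<omega>) \<le> R" "B 0 \<omega> = b" for \<omega>
      using norm_triangle_ineq4[of "B t \<omega>" "B 0 \<omega>"] that by simp
    then have le: "prob {\<omega>\<in>space M. norm (B t \<omega>) \<le> R} \<le> prob {\<omega>\<in>space M. B t \<omega> - B 0 \<omega> \<in> A}"
      using B_start by (intro finite_measure_mono_AE) (auto simp: A_def)
    have nn: "0 \<le> 1 / (2 * pi * t) * measure lborel A"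
      by (intro mult_nonneg_nonneg measure_nonneg) (use t in simp)
    have "emeasure M {\<omega>\<in>space M. B t \<omega> - B 0 \<omega> \<in> A} =
        (\<integral>\<^sup>+z. ennreal (planar_normal_density (sqrt t) z) * indicator A z \<partial>lborel)"
      using distributed_emeasure[OF d, of A] by (simp add: vimage_def Int_def conj_commute)
    also have "\<dots> \<le> (\<integral>\<^sup>+z. ennreal (1 / (2 * pi * t)) * indicator A z \<partial>lborel)"
    proof (intro nn_integral_mono mult_right_mono ennreal_leI)
      fix z
      have "normal_density 0 (sqrt t) x \<le> 1 / sqrt (2 * pi * t)" for x
        using t by (simp add: normal_density_def divide_right_mono)
      then have "planar_normal_density (sqrt t) z \<le> 1 / sqrt (2 * pi * t) * (1 / sqrt (2 * pi * t))"
        unfolding planar_normal_density_def by (intro mult_mono) (use t in auto)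
      then show "planar_normal_density (sqrt t) z \<le> 1 / (2 * pi * t)" using t by simp
    qed simp
    also have "\<dots> = ennreal (1 / (2 * pi * t)) * emeasure lborel A"
      by (simp add: nn_integral_cmult_indicator)
    also have "emeasure lborel A = ennreal (measure lborel A)"
      unfolding A_def by (intro emeasure_eq_ennreal_measure) (use emeasure_lborel_cball_finite[of 0 "R + norm b"] in \<open>simp add: less_top\<close>)
    also have "ennreal (1 / (2 * pi * t)) * ennreal (measure lborel A) = ennreal (1 / (2 * pi * t) * measure lborel A)"
      by (rule ennreal_mult[symmetric]) (use t in simp_all)
    finally have le': "prob {\<omega>\<in>space M. B t \<omega> - B 0 \<omega> \<in> A} \<le> 1 / (2 * pi * t) * measure lborel A"
      unfolding emeasure_eq_measure using nn by (simp only: ennreal_le_iff)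
    have eq: "1 / (2 * pi * t) * measure lborel A = C / (2 * pi) * inverse t"
      unfolding C_def A_def by (simp only: divide_inverse inverse_mult_distrib mult_ac mult_1_left)
    show ?thesis using order_trans[OF le le'] unfolding eq unfolding t_def .
  qed
  show ?thesis
  proof (rule tendsto_sandwich[where f = "\<lambda>_. 0"])
    show "(\<lambda>n. C / (2 * pi) * inverse (real (Suc n))) \<longlonglongrightarrow> 0"
      using tendsto_mult_left[OF LIMSEQ_inverse_real_of_nat, of "C / (2 * pi)"] by simp
    show "\<forall>\<^sub>F n in sequentially. prob {\<omega>\<in>space M. norm (B (real (Suc n)) \<omega>) \<le> R} \<le> C / (2 * pi) * inverse (real (Suc n))"
      by (intro always_eventually allI bound)
  qed simp_all
qed

text \<open>The function \<open>norm w powr s\<close> is at most 1, is small far away, and is subharmonic off the slit.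
On paths that avoid the slit up to a late time, the Brownian motion is far away with high
probability, so optional stopping yields that the slit is hit with probability at least
\<open>norm (w b) powr s\<close>, for every \<open>s > 0\<close>. As \<open>s\<close> tends to 0 this bound tends to 1.\<close>

lemma hits_almost_surely: "AE \<omega> in M. hitting_time B slit \<omega> < \<infinity>"
proof -
  define w where "w = norm (joukowski_inv b)"
  have w: "w > 0" by (simp add: w_def joukowski_inv_nonzero)
  define H where "H = hits"
  have Hm[measurable]: "H \<in> sets M" unfolding H_def by (rule hits_measurable)
  have ge: "prob H \<ge> w powr s - \<epsilon> powr s" if s: "s > 0" and \<epsilon>: "\<epsilon> > 0" for s \<epsilon>
  proof -
    define u where "u z = norm (joukowski_inv z) powr s" for z
    have u1: "0 \<le> u z" "u z \<le> 1" for z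
      using norm_joukowski_inv_le_1[of z] powr_mono2[of s "norm (joukowski_inv z)" 1] s by (auto simp: u_def)
    have ucont: "continuous_on UNIV u"
      unfolding u_def by (intro continuous_on_powr' continuous_on_norm_joukowski_inv continuous_on_const)
        (auto simp: joukowski_inv_nonzero)
    then have [measurable]: "u \<in> borel_measurable borel" by (rule borel_measurable_continuous_onI)
    define R where "R = 1 / \<epsilon> + 1"
    have "w powr s \<le> prob H + prob {\<omega>\<in>space M. norm (B (real (Suc n)) \<omega>) \<le> R} + \<epsilon> powr s" for n
    proof -
      define t where "t = real (Suc n)"
      have t: "t > 0" by (simp add: t_def)
      define A where "A = {\<omega>\<in>space M. norm (B t \<omega>) \<le> R}"
      have [measurable]: "B t \<in> borel_measurable M" "stopped t \<in> borel_measurable M"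
        using t by (auto intro: B_measurable)
      have Am[measurable]: "A \<in> sets M" unfolding A_def by measurable
      have "w powr s \<le> expectation (\<lambda>\<omega>. u (stopped t \<omega>))"
        using stopped_expectation_ge[OF closed_segment _ t ucont, of "-1" 1] u1
          norm_joukowski_inv_powr_supported[OF s] unfolding w_def u_def by (simp add: abs_le_iff)
      also have "\<dots> \<le> expectation (\<lambda>\<omega>. indicator H \<omega> + indicator A \<omega> + \<epsilon> powr s)"
      proof (rule integral_mono)
        show "integrable M (\<lambda>\<omega>. u (stopped t \<omega>))"
          using u1 by (intro integrable_const_bound[where B = 1]) auto
        show "integrable M (\<lambda>\<omega>. indicator H \<omega> + indicator A \<omega> + \<epsilon> powr s)"
          by (intro Bochner_Integration.integrable_add) (auto simp: integrable_indicator_iff less_top[symmetric])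
        fix \<omega> assume \<omega>: "\<omega> \<in> space M"
        show "u (stopped t \<omega>) \<le> indicator H \<omega> + indicator A \<omega> + \<epsilon> powr s"
        proof (cases "\<omega> \<in> H \<or> \<omega> \<in> A")
          case True
          then show ?thesis
            using u1[of "stopped t \<omega>"] powr_ge_zero[of \<epsilon> s] by (auto simp: indicator_def intro: order_trans)
        next
          case False
          then have "stopped t \<omega> = B t \<omega>"
            using stop_time_hitting_time_infinite(2)[of B slit \<omega> t] \<omega> t by (auto simp: H_def)
          moreover have "norm (B t \<omega>) \<ge> R" using False \<omega> by (auto simp: A_def)
          then have "norm (joukowski_inv (B t \<omega>)) \<le> \<epsilon>"
            unfolding R_def using norm_joukowski_inv_small[OF \<epsilon>] by blast
          ultimately have "u (stopped t \<omega>) \<le> \<epsilon> powr s"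
            unfolding u_def using s by (simp add: powr_mono2)
          then show ?thesis by (simp add: indicator_def)
        qed
      qed
      also have "\<dots> = prob H + prob A + \<epsilon> powr s"
        by (simp add: prob_space less_top[symmetric])
      finally show ?thesis by (simp add: A_def t_def)
    qed
    moreover have "(\<lambda>n. prob H + prob {\<omega>\<in>space M. norm (B (real (Suc n)) \<omega>) \<le> R} + \<epsilon> powr s)
        \<longlonglongrightarrow> prob H + 0 + \<epsilon> powr s"
      by (intro tendsto_intros prob_in_ball_tendsto_0)
    ultimately have "w powr s \<le> prob H + 0 + \<epsilon> powr s" by (meson LIMSEQ_le_const)
    then show ?thesis by simp
  qed
  have ge': "prob H \<ge> w powr s" if "s > 0" for s
  proof (rule tendsto_upperbound)
    show "((\<lambda>\<epsilon>. w powr s - \<epsilon> powr s) \<longlongrightarrow> w powr s) (at_right 0)"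
    proof -
      have "((\<lambda>\<epsilon>. w powr s - \<epsilon> powr s) \<longlongrightarrow> w powr s - 0 powr s) (at_right 0)"
        using that by (intro tendsto_intros tendsto_powr2) (auto simp: eventually_at_filter)
      then show ?thesis by simp
    qed
    show "\<forall>\<^sub>F \<epsilon> in at_right 0. w powr s - \<epsilon> powr s \<le> prob H"
      using eventually_at_right_less[of 0] by eventually_elim (rule ge[OF that])
  qed auto
  have "prob H \<ge> 1"
  proof (rule tendsto_upperbound)
    show "((\<lambda>s. w powr s) \<longlongrightarrow> 1) (at_right 0)"
    proof -
      have "((\<lambda>s. w powr s) \<longlongrightarrow> w powr 0) (at_right 0)" using w by (intro tendsto_intros) auto
      then show ?thesis using w by simp
    qed
    show "\<forall>\<^sub>F s in at_right 0. w powr s \<le> prob H"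
      using eventually_at_right_less[of 0] by eventually_elim (rule ge')
  qed auto
  then have "prob H = 1" using prob_le_1[of H] by linarith
  then have "AE \<omega> in M. \<omega> \<in> H" by (simp add: prob_eq_1)
  then show ?thesis by (simp add: H_def)
qed

text \<open>Stopping at \<open>t\<close> preserves the mean of \<open>Re (w ^ n)\<close>, and as \<open>t\<close> tends to infinity the stopped value becomes
the hitting point, since the slit is hit almost surely.\<close>

lemma hitting_point_chebyshev_moment:
  "expectation (\<lambda>\<omega>. Re (joukowski_inv (hitting_point B slit \<omega>) ^ n)) = Re (joukowski_inv b ^ n)"
proof -
  define u where "u z = Re (joukowski_inv z ^ n)" for z
  have u1: "\<bar>u z\<bar> \<le> 1" for z
    using abs_Re_le_cmod[of "joukowski_inv z ^ n"] norm_joukowski_inv_le_1[of z]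
    by (simp add: u_def norm_power) (meson norm_ge_zero order_trans power_le_one)
  have cont: "continuous_on UNIV u" unfolding u_def by (rule continuous_on_Re_joukowski_inv_power)
  then have um[measurable]: "u \<in> borel_measurable borel" by (rule borel_measurable_continuous_onI)
  have ucont: "isCont u z" for z using cont by (simp add: continuous_on_eq_continuous_at)
  have eq: "expectation (\<lambda>\<omega>. u (stopped t \<omega>)) = u b" if t: "t > 0" for t
  proof (rule antisym)
    have "holomorphically_supported_off slit (\<lambda>z. - u z)" "holomorphically_supported_off slit u"
      using joukowski_inv_supported[of "-1" n] joukowski_inv_supported[of 1 n] by (simp_all add: u_def[abs_def])
    moreover have "slit \<noteq> {}" by simp
    ultimately have "- u b \<le> expectation (\<lambda>\<omega>. - u (stopped t \<omega>))"
      "u b \<le> expectation (\<lambda>\<omega>. u (stopped t \<omega>))"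
      using stopped_expectation_ge[OF closed_segment _ t continuous_on_minus[OF cont], of "-1" 1]
        stopped_expectation_ge[OF closed_segment _ t cont, of "-1" 1] u1 by simp_all
    then show "expectation (\<lambda>\<omega>. u (stopped t \<omega>)) \<le> u b"
      "expectation (\<lambda>\<omega>. u (stopped t \<omega>)) \<ge> u b" by simp_all
  qed
  have "(\<lambda>m. expectation (\<lambda>\<omega>. u (stopped (real (Suc m)) \<omega>))) \<longlonglongrightarrow> expectation (\<lambda>\<omega>. u (hitting_point B slit \<omega>))"
  proof (rule integral_dominated_convergence)
    show "AE \<omega> in M. (\<lambda>m. u (stopped (real (Suc m)) \<omega>)) \<longlonglongrightarrow> u (hitting_point B slit \<omega>)"
      using hits_almost_surely AE_space
      by eventually_elim (intro isCont_tendsto_compose[OF ucont] stopped_tendsto_hitting_point, simp)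
    show "(\<lambda>\<omega>. u (stopped (real (Suc m)) \<omega>)) \<in> borel_measurable M" for m
      by (rule measurable_compose[OF stopped_measurable um]) simp
    show "AE \<omega> in M. norm (u (stopped (real (Suc m)) \<omega>)) \<le> 1" for m using u1 by simp
  qed auto
  then have "expectation (\<lambda>\<omega>. u (hitting_point B slit \<omega>)) = u b"
    using eq by (simp add: LIMSEQ_const_iff)
  then show ?thesis by (simp add: u_def)
qed

lemma hitting_point_in_slit: "AE \<omega> in M. hitting_point B slit \<omega> \<in> slit"
  using hits_almost_surely AE_space
proof eventually_elim
  case (elim \<omega>)
  then have "\<omega> \<in> hits" by simp
  then show ?case using hits_finiteE by metis
qed

end

section \<open>The periodized Cauchy kernel\<close>

text \<open>The logarithmic derivative of the reflection formula of the Gamma function.\<close>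

lemma Digamma_reflection:
  assumes "Im z \<noteq> 0"
  shows "Digamma z - Digamma (1 - z) = - of_real pi * cos (of_real pi * z) / sin (of_real pi * z)"
proof -
  have z: "z \<notin> \<int>\<^sub>\<le>\<^sub>0" "1 - z \<notin> \<int>\<^sub>\<le>\<^sub>0"
    using assms by (auto elim!: nonpos_Ints_cases simp: complex_eq_iff)
  have s0: "sin (of_real pi * z) \<noteq> 0"
  proof
    assume "sin (of_real pi * z) = 0"
    then obtain n :: int where "of_real pi * z = of_real (real_of_int n * pi)"
      by (auto simp: sin_eq_0)
    then have "Im (of_real pi * z) = Im (of_real (real_of_int n * pi))" by simp
    then show False using assms by simp
  qed
  have "((\<lambda>z. Gamma z * Gamma (1 - z)) has_field_derivative
      Gamma z * Gamma (1 - z) * (Digamma z - Digamma (1 - z))) (at z)"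
    using z by (auto intro!: derivative_eq_intros simp: algebra_simps)
  moreover have "((\<lambda>z. Gamma z * Gamma (1 - z)) has_field_derivative
      - (of_real pi)\<^sup>2 * cos (of_real pi * z) / (sin (of_real pi * z))\<^sup>2) (at z)"
    unfolding Gamma_reflection_complex using s0
    by (auto intro!: derivative_eq_intros simp: power2_eq_square)
  ultimately have "Gamma z * Gamma (1 - z) * (Digamma z - Digamma (1 - z)) =
      - (of_real pi)\<^sup>2 * cos (of_real pi * z) / (sin (of_real pi * z))\<^sup>2"
    by (rule DERIV_unique)
  then have "of_real pi / sin (of_real pi * z) * (Digamma z - Digamma (1 - z)) =
      of_real pi / sin (of_real pi * z) * (- of_real pi * cos (of_real pi * z) / sin (of_real pi * z))"
    unfolding Gamma_reflection_complex by (simp add: power2_eq_square)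
  moreover have "of_real pi / sin (of_real pi * z) \<noteq> 0" using s0 by simp
  ultimately show ?thesis using mult_left_cancel by blast
qed

lemma cot_eq_exp:
  assumes "Im z > 0"
  shows "- cos z / sin z = \<i> * (1 + exp (2 * \<i> * z)) / (1 - exp (2 * \<i> * z))"
proof -
  define e where "e = exp (\<i> * z)"
  have e: "e \<noteq> 0" "exp (- (\<i> * z)) = 1 / e" "exp (2 * \<i> * z) = e\<^sup>2"
    by (auto simp: e_def exp_minus inverse_eq_divide simp flip: exp_double mult.assoc)
  have "norm e < 1" using assms by (simp add: e_def)
  then have "norm (e\<^sup>2) < 1" by (simp add: norm_power power_less_one_iff)
  then have n: "e\<^sup>2 \<noteq> 1" by auto
  have c: "cos z = (e + 1 / e) / 2" "sin z = (e - 1 / e) / (2 * \<i>)"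
    using e by (simp_all add: cos_exp_eq sin_exp_eq e_def)
  have "cos z = (1 + e\<^sup>2) / (2 * e)" "sin z = \<i> * (1 - e\<^sup>2) / (2 * e)"
    unfolding c using e by (simp_all add: field_simps power2_eq_square)
  then have "- cos z / sin z = - ((1 + e\<^sup>2) / (2 * e)) / (\<i> * (1 - e\<^sup>2) / (2 * e))" by simp
  also have "\<dots> = \<i> * (1 + e\<^sup>2) / (1 - e\<^sup>2)"
    using e(1) n by (simp add: field_simps)
  finally show ?thesis unfolding e(3) .
qed

lemma has_sum_int_Un:
  fixes f :: "int \<Rightarrow> real"
  assumes "((\<lambda>n::nat. f (int n)) has_sum a) UNIV" "((\<lambda>n::nat. f (- int n - 1)) has_sum b) UNIV"
  shows "(f has_sum (a + b)) UNIV"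
proof -
  have "(f has_sum a) (range int)" using assms(1) by (subst has_sum_reindex) (auto simp: o_def)
  moreover have "(f has_sum b) (range (\<lambda>n. - int n - 1))"
    using assms(2) by (subst has_sum_reindex) (auto simp: o_def inj_on_def)
  moreover have "range int \<inter> range (\<lambda>n. - int n - 1) = {}" by auto
  ultimately have "(f has_sum (a + b)) (range int \<union> range (\<lambda>n. - int n - 1))"
    by (rule has_sum_Un_disjoint)
  moreover have "range int \<union> range (\<lambda>n. - int n - 1) = UNIV"
  proof -
    have "k \<in> range int \<union> range (\<lambda>n. - int n - 1)" for k
    proof (cases "k \<ge> 0")
      case True
      then show ?thesis by (metis UnI1 nat_0_le rangeI)
    next
      case False
      then have "k = - int (nat (- k - 1)) - 1" by simp
      then show ?thesis by blast
    qed
    then show ?thesis by auto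
  qed
  ultimately show ?thesis by simp
qed

text \<open>The imaginary part of the series of the Digamma function; the divergent parts of that series are real.\<close>

lemma cauchy_kernel_half_sum:
  fixes y c :: real
  assumes c: "c \<noteq> 0"
  shows "((\<lambda>n. 1 / ((y + real n)\<^sup>2 + c\<^sup>2)) has_sum Im (Digamma (Complex y c)) / c) UNIV"
proof (rule sums_nonneg_imp_has_sum)
  have "(\<lambda>m. Im (of_real (ln (real m)) - (\<Sum>n<m. inverse (Complex y c + of_nat n)))) \<longlonglongrightarrow> Im (Digamma (Complex y c))"
    using c by (intro tendsto_Im Digamma_LIMSEQ) (auto simp: complex_eq_iff)
  moreover have "Im (inverse (Complex y c + of_nat n)) = - (c / ((y + real n)\<^sup>2 + c\<^sup>2))" for n
    by simp
  ultimately have "(\<lambda>n. c / ((y + real n)\<^sup>2 + c\<^sup>2)) sums Im (Digamma (Complex y c))"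
    by (simp add: sums_def sum_negf)
  from sums_divide[OF this, of c] c show "(\<lambda>n. 1 / ((y + real n)\<^sup>2 + c\<^sup>2)) sums (Im (Digamma (Complex y c)) / c)"
    by simp
qed simp

text \<open>The two half-lines of integers contribute the Digamma function at \<open>z = y + \<i> c\<close> and at \<open>1 - z\<close>, so the
reflection formula turns the sum into a cotangent, which is the Poisson kernel in \<open>E = exp (2 \<pi> \<i> z)\<close>.\<close>

lemma cauchy_kernel_periodized:
  fixes y c :: real
  assumes c: "c > 0"
  defines "E \<equiv> exp (2 * pi * \<i> * Complex y c)"
  shows "((\<lambda>k::int. c / ((y + of_int k)\<^sup>2 + c\<^sup>2)) has_sum pi * Re ((1 + E) / (1 - E))) UNIV"
proof -
  let ?z = "Complex y c"
  have z1: "1 - ?z = Complex (1 - y) (- c)" by (simp add: complex_eq_iff)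
  have "((\<lambda>n. 1 / ((y + of_int (int n))\<^sup>2 + c\<^sup>2)) has_sum Im (Digamma ?z) / c) UNIV"
    using cauchy_kernel_half_sum[of c y] c by simp
  moreover have "(y + of_int (- int n - 1))\<^sup>2 = (1 - y + real n)\<^sup>2" for n
    by (simp add: power2_eq_square algebra_simps)
  then have "((\<lambda>n. 1 / ((y + of_int (- int n - 1))\<^sup>2 + c\<^sup>2)) has_sum Im (Digamma (1 - ?z)) / - c) UNIV"
    using cauchy_kernel_half_sum[of "- c" "1 - y"] c unfolding z1 by simp
  ultimately have "((\<lambda>k::int. 1 / ((y + of_int k)\<^sup>2 + c\<^sup>2)) has_sum
      (Im (Digamma ?z) / c + Im (Digamma (1 - ?z)) / - c)) UNIV"
    by (rule has_sum_int_Un)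
  from has_sum_cmult_right[OF this, of c]
  have "((\<lambda>k::int. c / ((y + of_int k)\<^sup>2 + c\<^sup>2)) has_sum Im (Digamma ?z - Digamma (1 - ?z))) UNIV"
    using c by (simp add: right_diff_distrib)
  also have "Digamma ?z - Digamma (1 - ?z) = of_real pi * (- cos (of_real pi * ?z) / sin (of_real pi * ?z))"
    using c by (subst Digamma_reflection) auto
  also have "- cos (of_real pi * ?z) / sin (of_real pi * ?z) = \<i> * (1 + E) / (1 - E)"
    using c by (subst cot_eq_exp) (auto simp: E_def mult_ac)
  also have "Im (of_real pi * (\<i> * (1 + E) / (1 - E))) = pi * Re ((1 + E) / (1 - E))"
  proof -
    have "Im (of_real a * (\<i> * w)) = a * Re w" for a w by simp
    then show ?thesis unfolding times_divide_eq_right[symmetric] .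
  qed
  finally show ?thesis .
qed

lemma poisson_sums:
  fixes E :: complex
  assumes "norm E < 1"
  shows "(\<lambda>m. (if m = 0 then 1 else 2) * Re (E ^ m)) sums Re ((1 + E) / (1 - E))"
proof -
  have "E \<noteq> 1" using assms by auto
  have "(\<lambda>m. 2 * E ^ m - (if m = 0 then 1 else 0)) sums (2 * (1 / (1 - E)) - 1)"
    by (intro sums_diff sums_mult geometric_sums assms) (use sums_single[of 0 "\<lambda>_. 1"] in simp)
  moreover have "2 * (1 / (1 - E)) - 1 = (1 + E) / (1 - E)"
    using \<open>E \<noteq> 1\<close> by (simp add: field_simps)
  ultimately have "(\<lambda>m. Re (2 * E ^ m - (if m = 0 then 1 else 0))) sums Re ((1 + E) / (1 - E))"
    using sums_Re by metis
  moreover have "Re (2 * E ^ m - (if m = 0 then 1 else 0)) = (if m = 0 then 1 else 2) * Re (E ^ m)" for m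
    by auto
  ultimately show ?thesis by simp
qed

text \<open>The right-hand side of the formula to be proved. As \<open>x\<close> runs through \<open>[-1, 1]\<close>, it is the density of the
\<open>x\<close> for which \<open>sin (\<pi> x / 2)\<close> is the hitting point.\<close>

definition angle_density :: "real \<Rightarrow> real \<Rightarrow> real \<Rightarrow> real" where
  "angle_density \<alpha> \<beta> x = 1 / pi * (\<Sum>\<^sub>\<infinity>n\<in>(UNIV :: int set).
     \<beta> / (\<beta>\<^sup>2 + (\<alpha> - (2 * real_of_int n + (-1) powi n * x))\<^sup>2))"

text \<open>The signs in front of \<open>k\<close> make both subseries of Cauchy kernels take the form \<open>y + 4 k\<close>.\<close>

lemma has_sum_int_even_odd:
  fixes f :: "int \<Rightarrow> real"
  assumes "((\<lambda>k. f (- 2 * k)) has_sum a) UNIV" "((\<lambda>k. f (1 - 2 * k)) has_sum b) UNIV"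
  shows "(f has_sum (a + b)) UNIV"
proof -
  have "(f has_sum a) (range (\<lambda>k. - 2 * k))"
    using assms(1) by (subst has_sum_reindex) (auto simp: o_def inj_on_def)
  moreover have "(f has_sum b) (range (\<lambda>k. 1 - 2 * k))"
    using assms(2) by (subst has_sum_reindex) (auto simp: o_def inj_on_def)
  moreover have "range (\<lambda>k::int. - 2 * k) \<inter> range (\<lambda>k. 1 - 2 * k) = {}" by (auto; presburger)
  ultimately have "(f has_sum (a + b)) (range (\<lambda>k. - 2 * k) \<union> range (\<lambda>k. 1 - 2 * k))"
    by (rule has_sum_Un_disjoint)
  moreover have "k \<in> range (\<lambda>k. - 2 * k) \<union> range (\<lambda>k. 1 - 2 * k)" for k :: int
  proof (cases "even k")
    case True
    then have "k = - 2 * (- (k div 2))" by simp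
    then show ?thesis by blast
  next
    case False
    then have "k = 1 - 2 * (- ((k - 1) div 2))" by (auto elim!: oddE)
    then show ?thesis by blast
  qed
  then have "range (\<lambda>k. - 2 * k) \<union> range (\<lambda>k. 1 - 2 * k) = (UNIV :: int set)" by blast
  ultimately show ?thesis by simp
qed

lemma angle_density_eq:
  fixes \<alpha> \<beta> x :: real
  assumes \<beta>: "\<beta> > 0"
  defines "E \<equiv> \<lambda>y. exp (2 * pi * \<i> * Complex (y / 4) (\<beta> / 4))"
  shows "angle_density \<alpha> \<beta> x =
    (Re ((1 + E (\<alpha> - x)) / (1 - E (\<alpha> - x))) + Re ((1 + E (\<alpha> + x - 2)) / (1 - E (\<alpha> + x - 2)))) / 4"
proof -
  define f where "f n = \<beta> / (\<beta>\<^sup>2 + (\<alpha> - (2 * real_of_int n + (-1) powi n * x))\<^sup>2)" for n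
  define g where "g y k = 1 / 4 * ((\<beta> / 4) / ((y / 4 + real_of_int k)\<^sup>2 + (\<beta> / 4)\<^sup>2))" for y k
  have g: "g y k = \<beta> / (\<beta>\<^sup>2 + (y + 4 * real_of_int k)\<^sup>2)" for y k
  proof -
    have "(y / 4 + real_of_int k)\<^sup>2 + (\<beta> / 4)\<^sup>2 = (\<beta>\<^sup>2 + (y + 4 * real_of_int k)\<^sup>2) / 16"
      by (simp add: power2_eq_square field_simps)
    then show ?thesis by (simp add: g_def)
  qed
  have gs: "(g y has_sum pi / 4 * Re ((1 + E y) / (1 - E y))) UNIV" for y
  proof -
    have "\<beta> / 4 > 0" using \<beta> by simp
    from has_sum_cmult_right[OF cauchy_kernel_periodized[OF this, of "y / 4"], of "1 / 4"]
    show ?thesis unfolding g_def E_def by (simp only: mult.assoc[symmetric] times_divide_eq_left mult_1_left)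
  qed
  have even: "(-1 :: real) powi (- 2 * k) = 1" for k
    using power_int_mult[of "-1 :: real" 2 "- k"] by simp
  have odd: "(-1 :: real) powi (1 - 2 * k) = -1" for k
    using power_int_add[of "-1 :: real" 1 "- 2 * k"] even[of k] by simp
  have "f (- 2 * k) = g (\<alpha> - x) k" for k
    unfolding g f_def even by (simp add: algebra_simps)
  moreover have "f (1 - 2 * k) = g (\<alpha> + x - 2) k" for k
    unfolding g f_def odd by (simp add: algebra_simps)
  ultimately have "(f has_sum (pi / 4 * Re ((1 + E (\<alpha> - x)) / (1 - E (\<alpha> - x))) +
      pi / 4 * Re ((1 + E (\<alpha> + x - 2)) / (1 - E (\<alpha> + x - 2))))) UNIV"
    using gs by (intro has_sum_int_even_odd) auto
  from infsumI[OF this]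
  have "angle_density \<alpha> \<beta> x = 1 / pi * (pi / 4 * Re ((1 + E (\<alpha> - x)) / (1 - E (\<alpha> - x))) +
      pi / 4 * Re ((1 + E (\<alpha> + x - 2)) / (1 - E (\<alpha> + x - 2))))"
    unfolding angle_density_def f_def by (rule arg_cong)
  moreover have "1 / pi * (pi / 4 * r + pi / 4 * s) = (r + s) / 4" for r s
    by (simp add: field_simps)
  ultimately show ?thesis by (rule trans)
qed

lemma angle_density_nonneg: "\<beta> > 0 \<Longrightarrow> angle_density \<alpha> \<beta> x \<ge> 0"
  unfolding angle_density_def by (intro mult_nonneg_nonneg infsum_nonneg) auto

lemma norm_exp_kernel_less_1:
  "\<beta> > 0 \<Longrightarrow> norm (exp (2 * pi * \<i> * Complex (y / 4) (\<beta> / 4))) < 1"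
  by (simp add: norm_exp_eq_Re)

lemma continuous_angle_density:
  assumes "\<beta> > 0" shows "continuous_on A (angle_density \<alpha> \<beta>)"
proof -
  define E where "E y = exp (2 * pi * \<i> * Complex (y / 4) (\<beta> / 4))" for y
  have "continuous_on UNIV E"
    unfolding E_def Complex_eq by (intro continuous_intros) auto
  then have E: "continuous_on A (\<lambda>x. E (f x))" if "continuous_on A f" for f
    using that by (rule continuous_on_compose2) auto
  have ne: "1 - E y \<noteq> 0" for y
    using norm_exp_kernel_less_1[OF assms, of y] unfolding E_def[symmetric] by auto
  show ?thesis
    unfolding angle_density_eq[OF assms] E_def[symmetric]
    by (intro continuous_on_divide continuous_on_add continuous_on_diff continuous_on_Re continuous_on_const
        continuous_on_id E ballI ne) simp_all
qed

text \<open>The even \<open>n\<close> give a Poisson kernel at the angle \<open>\<theta> - \<phi>\<close> and the odd ones at \<open>\<theta> + \<phi>\<close>, where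
\<open>\<theta> = \<pi> (1 - x) / 2\<close>; in the sum of the two only cosines of \<open>\<theta>\<close> remain.\<close>

lemma angle_density_sums:
  fixes \<alpha> \<beta> x :: real
  assumes \<beta>: "\<beta> > 0"
  defines "q \<equiv> exp (- pi * \<beta> / 2)" and "\<phi> \<equiv> pi * (1 - \<alpha>) / 2"
  shows "(\<lambda>m. (if m = 0 then 1 / 2 else 1) * (q ^ m * cos (real m * \<phi>)) * cos (real m * (pi * (1 - x) / 2)))
    sums angle_density \<alpha> \<beta> x"
proof -
  define E where "E = (\<lambda>y. exp (2 * pi * \<i> * Complex (y / 4) (\<beta> / 4)))"
  have E: "E y = of_real q * cis (pi * y / 2)" for y
  proof -
    have "2 * pi * \<i> * Complex (y / 4) (\<beta> / 4) = of_real (- pi * \<beta> / 2) + \<i> * of_real (pi * y / 2)"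
      by (simp add: complex_eq_iff)
    then show ?thesis unfolding E_def q_def by (simp only: exp_add exp_of_real cis_conv_exp)
  qed
  have Em: "Re (E y ^ m) = q ^ m * cos (real m * (pi * y / 2))" for y m
    unfolding E power_mult_distrib Complex.DeMoivre by (simp flip: of_real_power)
  have "norm (E y) < 1" for y unfolding E_def by (rule norm_exp_kernel_less_1[OF \<beta>])
  from sums_divide[OF sums_add[OF poisson_sums[OF this] poisson_sums[OF this]], of "\<alpha> - x" "\<alpha> + x - 2" 4]
  have "(\<lambda>m. ((if m = 0 then 1 else 2) * Re (E (\<alpha> - x) ^ m) + (if m = 0 then 1 else 2) * Re (E (\<alpha> + x - 2) ^ m)) / 4)
      sums angle_density \<alpha> \<beta> x"
    unfolding angle_density_eq[OF \<beta>] E_def .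
  moreover have "((if m = 0 then 1 else 2) * Re (E (\<alpha> - x) ^ m) + (if m = 0 then 1 else 2) * Re (E (\<alpha> + x - 2) ^ m)) / 4
      = (if m = 0 then 1 / 2 else 1) * (q ^ m * cos (real m * \<phi>)) * cos (real m * (pi * (1 - x) / 2))" for m
  proof -
    define a c where "a = real m * (pi * (1 - x) / 2)" and "c = real m * \<phi>"
    have ac: "real m * (pi * (\<alpha> - x) / 2) = a - c" "real m * (pi * (\<alpha> + x - 2) / 2) = - (a + c)"
      by (simp_all add: a_def c_def \<phi>_def field_simps)
    show ?thesis
      unfolding Em ac a_def[symmetric] c_def[symmetric] by (simp add: cos_add cos_diff algebra_simps)
  qed
  ultimately show ?thesis by simp
qed

lemma cos_integral_orthogonal:
  fixes m n :: nat
  shows "has_bochner_integral lborel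
    (\<lambda>x. cos (real m * (pi * (1 - x) / 2)) * cos (real n * (pi * (1 - x) / 2)) * indicator {-1..1} x)
    (if m = n then (if m = 0 then 2 else 1) else 0)"
proof -
  have I: "has_bochner_integral lborel (\<lambda>x. cos (of_int k * (pi * (1 - x) / 2)) * indicator {-1..1} x) (if k = 0 then 2 else 0)" for k :: int
  proof (cases "k = 0")
    case True
    then show ?thesis using has_bochner_integral_real_indicator[of "{-1..1::real}" lborel] by simp
  next
    case False
    have "has_bochner_integral lborel (\<lambda>x. cos (of_int k * (pi * (1 - x) / 2)) * indicator {-1..1} x)
        (- 2 / (of_int k * pi) * sin (of_int k * (pi * (1 - 1) / 2)) - - 2 / (of_int k * pi) * sin (of_int k * (pi * (1 - - 1) / 2)))"
    proof (rule has_bochner_integral_FTC_Icc_real[where F = "\<lambda>x. - 2 / (of_int k * pi) * sin (of_int k * (pi * (1 - x) / 2))"])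
      show "((\<lambda>x. - 2 / (of_int k * pi) * sin (of_int k * (pi * (1 - x) / 2))) has_real_derivative cos (of_int k * (pi * (1 - x) / 2))) (at x)" for x
        using False by (auto intro!: derivative_eq_intros)
      show "isCont (\<lambda>x. cos (of_int k * (pi * (1 - x) / 2))) x" for x by (intro continuous_intros) auto
    qed simp
    moreover have "sin (of_int k * (pi * (1 - - 1) / 2)) = 0" by (simp add: sin_times_pi_eq_0)
    ultimately show ?thesis using False by simp
  qed
  have c: "cos (real m * (pi * (1 - x) / 2)) * cos (real n * (pi * (1 - x) / 2)) =
      1 / 2 * cos (of_int (int m - int n) * (pi * (1 - x) / 2)) + 1 / 2 * cos (of_int (int m + int n) * (pi * (1 - x) / 2))" for x
    by (simp add: cos_times_cos algebra_simps add_divide_distrib diff_divide_distrib)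
  have v: "(if m = n then (if m = 0 then 2 else 1) else 0) =
      1 / 2 * (if int m - int n = 0 then 2 else 0) + 1 / 2 * (if int m + int n = 0 then 2 else (0::real))"
    by auto
  show ?thesis
    unfolding c v distrib_right mult.assoc
    by (intro has_bochner_integral_add has_bochner_integral_mult_right I[unfolded mult.assoc])
qed

text \<open>Orthogonality of the cosines on \<open>[-1, 1]\<close> picks the \<open>n\<close>-th Fourier coefficient; the geometric decay of
the coefficients justifies the integration term by term.\<close>

lemma angle_density_moment:
  fixes \<alpha> \<beta> :: real and n :: nat
  assumes \<beta>: "\<beta> > 0"
  defines "q \<equiv> exp (- pi * \<beta> / 2)" and "\<phi> \<equiv> pi * (1 - \<alpha>) / 2"
  shows "(\<integral>x. angle_density \<alpha> \<beta> x * cos (real n * (pi * (1 - x) / 2)) * indicator {-1..1} x \<partial>lborel)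
    = q ^ n * cos (real n * \<phi>)"
proof -
  define a where "a m = (if m = 0 then 1 / 2 else 1) * (q ^ m * cos (real m * \<phi>))" for m :: nat
  define f where "f m x = a m * (cos (real m * (pi * (1 - x) / 2)) * cos (real n * (pi * (1 - x) / 2)) * indicator {-1..1} x)" for m x
  have q: "0 < q" "q < 1" using \<beta> by (auto simp: q_def)
  have an: "\<bar>a m\<bar> \<le> q ^ m" for m
    using q mult_left_mono[of "\<bar>cos (real m * \<phi>)\<bar>" 1 "q ^ m"] by (auto simp: a_def abs_mult)
  have fb: "\<bar>f m x\<bar> \<le> q ^ m * indicator {-1..1} x" for m x
    unfolding f_def abs_mult
    by (intro mult_mono an order_trans[OF mult_mono[OF mult_mono[OF abs_cos_le_one abs_cos_le_one] order_refl]])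
      (use q in \<open>auto simp: indicator_def\<close>)
  have fi: "has_bochner_integral lborel (f m) (a m * (if m = n then (if m = 0 then 2 else 1) else 0))" for m
    unfolding f_def by (intro has_bochner_integral_mult_right cos_integral_orthogonal)
  have "(\<lambda>m. integral\<^sup>L lborel (f m)) sums (\<integral>x. (\<Sum>m. f m x) \<partial>lborel)"
  proof (rule sums_integral)
    show "integrable lborel (f m)" for m using fi by (auto simp: has_bochner_integral_iff)
    have sq: "summable (\<lambda>m. q ^ m)" using q by (intro summable_geometric) auto
    show "AE x in lborel. summable (\<lambda>m. norm (f m x))"
    proof (intro AE_I2 summable_comparison_test[OF _ sq] exI[of _ 0] allI impI)
      fix x m show "norm (norm (f m x)) \<le> q ^ m"
        using fb[of m x] q by (cases "x \<in> {-1..1}") (auto intro: order_trans)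
    qed
    have "(\<integral>x. norm (f m x) \<partial>lborel) \<le> (\<integral>x. q ^ m * indicator {-1..1::real} x \<partial>lborel)" for m
    proof (rule Bochner_Integration.integral_mono)
      show "integrable lborel (\<lambda>x. norm (f m x))" using fi[of m] by (auto simp: has_bochner_integral_iff)
      show "integrable lborel (\<lambda>x. q ^ m * indicator {-1..1::real} x)" by simp
      show "norm (f m x) \<le> q ^ m * indicator {-1..1} x" for x using fb by simp
    qed
    then have "(\<integral>x. norm (f m x) \<partial>lborel) \<le> 2 * q ^ m" for m by (simp add: mult.commute)
    then show "summable (\<lambda>m. \<integral>x. norm (f m x) \<partial>lborel)"
      by (intro summable_comparison_test[OF _ summable_mult[OF sq, of 2]]) auto
  qed
  moreover have "integral\<^sup>L lborel (f m) = (if m = n then q ^ n * cos (real n * \<phi>) else 0)" for m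
    using fi[of m] by (auto simp: has_bochner_integral_iff a_def)
  ultimately have "(\<integral>x. (\<Sum>m. f m x) \<partial>lborel) = q ^ n * cos (real n * \<phi>)"
    using sums_single[of n "\<lambda>_. q ^ n * cos (real n * \<phi>)"] by (simp add: sums_unique2)
  moreover have "(\<Sum>m. f m x) = angle_density \<alpha> \<beta> x * cos (real n * (pi * (1 - x) / 2)) * indicator {-1..1} x" for x
  proof -
    have "(\<lambda>m. a m * cos (real m * (pi * (1 - x) / 2))) sums angle_density \<alpha> \<beta> x"
      using angle_density_sums[OF \<beta>] unfolding a_def q_def \<phi>_def .
    then have "(\<lambda>m. a m * cos (real m * (pi * (1 - x) / 2)) * (cos (real n * (pi * (1 - x) / 2)) * indicator {-1..1} x))
       sums (angle_density \<alpha> \<beta> x * (cos (real n * (pi * (1 - x) / 2)) * indicator {-1..1} x))" by (rule sums_mult2)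
    then show ?thesis by (intro sums_unique[symmetric]) (simp add: f_def mult_ac)
  qed
  ultimately show ?thesis by simp
qed

section \<open>The hitting law\<close>

text \<open>On a bounded interval the partial sums of the exponential series converge to the characteristic
function, so the moments determine it and hence the law.\<close>

lemma real_distribution_eqI_moments:
  assumes "real_distribution M1" "real_distribution M2"
    and b1: "AE x in M1. \<bar>x\<bar> \<le> 1" and b2: "AE x in M2. \<bar>x\<bar> \<le> 1"
    and eq: "\<And>k. (\<integral>x. x ^ k \<partial>M1) = (\<integral>x. x ^ k \<partial>M2)"
  shows "M1 = M2"
proof (rule Levy_uniqueness)
  show "char M1 = char M2"
  proof
    fix t :: real
    define c where "c M n = (\<Sum>k\<le>n. ((\<i> * t) ^ k / fact k) * (\<integral>x. x ^ k \<partial>M))" for M :: "real measure" and n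
    have approx: "norm (char M t - c M n) \<le> 2 * (\<bar>t\<bar> ^ n / fact n)"
      if "real_distribution M" "AE x in M. \<bar>x\<bar> \<le> 1" for M n
    proof -
      interpret real_distribution M by fact
      have "norm (char M t - c M n) \<le> (2 * \<bar>t\<bar> ^ n / fact n) * expectation (\<lambda>x. \<bar>x\<bar> ^ n)"
        unfolding c_def
      proof (rule char_approx1)
        show "integrable M (\<lambda>x. x ^ k)" for k
          using that(2) by (intro integrable_const_bound[where B = 1]) (auto simp: power_abs power_le_one elim!: eventually_mono)
      qed
      also have "expectation (\<lambda>x. \<bar>x\<bar> ^ n) \<le> 1"
        using that(2) by (intro integral_le_const integrable_const_bound[where B = 1]) (auto simp: power_abs power_le_one elim!: eventually_mono)
      then have "(2 * \<bar>t\<bar> ^ n / fact n) * expectation (\<lambda>x. \<bar>x\<bar> ^ n) \<le> (2 * \<bar>t\<bar> ^ n / fact n) * 1"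
        by (intro mult_left_mono) auto
      finally show ?thesis by simp
    qed
    have lim: "c M \<longlonglongrightarrow> char M t" if M: "real_distribution M" "AE x in M. \<bar>x\<bar> \<le> 1" for M
    proof -
      have "(\<lambda>n. \<bar>t\<bar> ^ n / fact n) \<longlonglongrightarrow> 0"
        using summable_LIMSEQ_zero[OF summable_exp[of "\<bar>t\<bar>"]] by (simp add: divide_inverse mult.commute)
      then have "(\<lambda>n. 2 * (\<bar>t\<bar> ^ n / fact n)) \<longlonglongrightarrow> 0" by (rule tendsto_mult_right_zero)
      moreover have "\<forall>\<^sub>F n in sequentially. norm (c M n - char M t) \<le> 2 * (\<bar>t\<bar> ^ n / fact n)"
        using approx[OF M] by (simp add: norm_minus_commute)
      ultimately have "(\<lambda>n. c M n - char M t) \<longlonglongrightarrow> 0" by (rule Lim_null_comparison[rotated])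
      then show ?thesis by (rule LIM_zero_cancel)
    qed
    have "c M1 = c M2" unfolding c_def eq by simp
    then show "char M1 t = char M2 t" using lim[OF assms(1) b1] lim[OF assms(2) b2] LIMSEQ_unique by metis
  qed
qed fact+

text \<open>Defined through the inverse Joukowski map, this is a continuous function bounded by 1 on the whole
line; it agrees with the Chebyshev polynomial on \<open>[-1, 1]\<close>.\<close>

definition chebyshev :: "nat \<Rightarrow> real \<Rightarrow> real" where
  "chebyshev n x = Re (joukowski_inv (of_real x) ^ n)"

lemma of_real_in_slit: "of_real x \<in> slit \<longleftrightarrow> \<bar>x\<bar> \<le> 1"
  by (simp add: mem_unit_segment_iff)

lemma chebyshev_eq: "\<bar>x\<bar> \<le> 1 \<Longrightarrow> chebyshev n x = cos (real n * arccos x)"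
  unfolding chebyshev_def using Re_joukowski_inv_power_segment[of "of_real x" n] of_real_in_slit[of x] by simp

lemma abs_chebyshev_le_1: "\<bar>chebyshev n x\<bar> \<le> 1"
proof -
  have "\<bar>chebyshev n x\<bar> \<le> norm (joukowski_inv (of_real x) ^ n)"
    unfolding chebyshev_def by (rule abs_Re_le_cmod)
  also have "\<dots> \<le> 1" by (simp add: norm_power power_le_one norm_joukowski_inv_le_1)
  finally show ?thesis .
qed

lemma borel_measurable_chebyshev [measurable]: "chebyshev n \<in> borel_measurable borel"
proof (rule borel_measurable_continuous_onI)
  show "continuous_on UNIV (chebyshev n)"
    unfolding chebyshev_def
    by (rule continuous_on_compose2[OF continuous_on_Re_joukowski_inv_power[of UNIV]]) (auto intro!: continuous_intros)
qed

lemma chebyshev_recurrence: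
  assumes "\<bar>x\<bar> \<le> 1"
  shows "x * chebyshev 0 x = chebyshev 1 x"
    and "x * chebyshev (Suc n) x = (chebyshev n x + chebyshev (Suc (Suc n)) x) / 2"
proof -
  define a where "a = arccos x"
  have x: "x = cos a" using assms by (simp add: a_def cos_arccos_abs)
  show "x * chebyshev 0 x = chebyshev 1 x" using assms by (simp add: chebyshev_eq a_def[symmetric] x[symmetric])
  define c where "c = real (Suc n) * a"
  have "real n * a = c - a" "real (Suc (Suc n)) * a = c + a" by (simp_all add: c_def algebra_simps)
  then have "(cos (real n * a) + cos (real (Suc (Suc n)) * a)) / 2 = cos a * cos (real (Suc n) * a)"
    unfolding c_def[symmetric] by (simp add: cos_add cos_diff)
  then show "x * chebyshev (Suc n) x = (chebyshev n x + chebyshev (Suc (Suc n)) x) / 2"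
    unfolding chebyshev_eq[OF assms] a_def[symmetric] x[symmetric] by simp
qed

text \<open>The recurrence of the Chebyshev polynomials expresses the mean of \<open>x ^ Suc k * chebyshev n x\<close> by means
with the exponent \<open>k\<close>; with \<open>n = 0\<close> these are the moments.\<close>

lemma real_distribution_eqI_chebyshev:
  assumes M: "real_distribution M1" "real_distribution M2"
    and b: "AE x in M1. \<bar>x\<bar> \<le> 1" "AE x in M2. \<bar>x\<bar> \<le> 1"
    and eq: "\<And>n. (\<integral>x. chebyshev n x \<partial>M1) = (\<integral>x. chebyshev n x \<partial>M2)"
  shows "M1 = M2"
proof (rule real_distribution_eqI_moments[OF M b])
  define I where "I M k n = (\<integral>x. x ^ k * chebyshev n x \<partial>M)" for M :: "real measure" and k n
  have rec: "I M (Suc k) 0 = I M k 1 \<and> I M (Suc k) (Suc n) = (I M k n + I M k (Suc (Suc n))) / 2"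
    if M: "real_distribution M" and b: "AE x in M. \<bar>x\<bar> \<le> 1" for M k n
  proof -
    interpret real_distribution M by fact
    have int: "integrable M (\<lambda>x. x ^ k * chebyshev n x)" for k n
    proof (rule integrable_const_bound[where B = 1])
      show "AE x in M. norm (x ^ k * chebyshev n x) \<le> 1"
        using b
      proof eventually_elim
        case (elim x)
        then have "\<bar>x ^ k\<bar> \<le> 1" by (simp add: power_abs power_le_one)
        then show ?case using abs_chebyshev_le_1[of n x] by (simp add: abs_mult mult_le_one)
      qed
    qed simp
    have "I M (Suc k) 0 = I M k 1"
      unfolding I_def
    proof (rule integral_cong_AE)
      show "AE x in M. x ^ Suc k * chebyshev 0 x = x ^ k * chebyshev 1 x"
        using b
      proof eventually_elim
        case (elim x)
        then show ?case using chebyshev_recurrence(1)[of x] by (metis mult.assoc power_Suc2)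
      qed
    qed simp_all
    moreover have "I M (Suc k) (Suc n) = (\<integral>x. (x ^ k * chebyshev n x + x ^ k * chebyshev (Suc (Suc n)) x) / 2 \<partial>M)"
      unfolding I_def
    proof (rule integral_cong_AE)
      show "AE x in M. x ^ Suc k * chebyshev (Suc n) x = (x ^ k * chebyshev n x + x ^ k * chebyshev (Suc (Suc n)) x) / 2"
        using b
      proof eventually_elim
        case (elim x)
        have "x ^ Suc k * chebyshev (Suc n) x = x ^ k * (x * chebyshev (Suc n) x)" by simp
        then show ?case unfolding chebyshev_recurrence(2)[OF elim] by (simp add: algebra_simps)
      qed
    qed simp_all
    then have "I M (Suc k) (Suc n) = (I M k n + I M k (Suc (Suc n))) / 2"
      using int by (simp add: I_def)
    ultimately show ?thesis by blast
  qed
  have "I M1 k n = I M2 k n" for k n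
  proof (induction k arbitrary: n)
    case 0
    then show ?case using eq by (simp add: I_def)
  next
    case (Suc k)
    show ?case
      by (cases n) (simp_all add: rec[OF M(1) b(1)] rec[OF M(2) b(2)] Suc.IH)
  qed
  from this[of _ 0] show "(\<integral>x. x ^ k \<partial>M1) = (\<integral>x. x ^ k \<partial>M2)" for k
    by (simp add: I_def chebyshev_def)
qed

text \<open>The density that \<^const>\<open>angle_density\<close> becomes under \<open>x \<mapsto> sin (\<pi> x / 2)\<close>. The value 0 at the end points
of the slit is arbitrary, as the density is unbounded near them.\<close>

definition slit_density :: "real \<Rightarrow> real \<Rightarrow> complex \<Rightarrow> real" where
  "slit_density \<alpha> \<beta> z = (if \<bar>Re z\<bar> < 1
     then angle_density \<alpha> \<beta> (2 / pi * arcsin (Re z)) / (pi / 2 * sqrt (1 - (Re z)\<^sup>2)) else 0)"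

context
  fixes \<alpha> \<beta> :: real
  assumes \<beta>: "\<beta> > 0"
begin

lemma slit_density_nonneg: "slit_density \<alpha> \<beta> z \<ge> 0"
  using angle_density_nonneg[OF \<beta>] by (auto simp: slit_density_def abs_square_le_1)

lemma slit_density_sin:
  assumes "x \<in> {-1<..<1}"
  shows "pi / 2 * cos (pi / 2 * x) * slit_density \<alpha> \<beta> (of_real (sin (pi / 2 * x))) = angle_density \<alpha> \<beta> x"
proof -
  define y where "y = pi / 2 * x"
  have y: "- (pi / 2) < y" "y < pi / 2" 
    using assms mult_strict_left_mono[of "-1" x "pi / 2"] mult_strict_left_mono[of x 1 "pi / 2"]
    by (auto simp: y_def)
  have c: "cos y > 0" using y by (intro cos_gt_zero_pi) auto
  then have s: "sqrt (1 - (sin y)\<^sup>2) = cos y" by (simp add: cos_squared_eq[symmetric])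
  have "\<bar>sin y\<bar> < 1"
  proof -
    have "(sin y)\<^sup>2 < 1" using c by (simp add: sin_squared_eq)
    then show ?thesis by (simp add: abs_square_less_1)
  qed
  moreover have "arcsin (sin y) = y" using y by (intro arcsin_sin) auto
  moreover have "2 / pi * y = x" by (simp add: y_def)
  ultimately have "slit_density \<alpha> \<beta> (of_real (sin y)) = angle_density \<alpha> \<beta> x / (pi / 2 * cos y)"
    by (simp only: slit_density_def Re_complex_of_real if_True s)
  then show ?thesis unfolding y_def[symmetric] using c by simp
qed

lemma continuous_on_slit_density_interval:
  "continuous_on {-1<..<1} (\<lambda>x. slit_density \<alpha> \<beta> (of_real x))"
proof -
  have "continuous_on {-1<..<1} (\<lambda>x. angle_density \<alpha> \<beta> (2 / pi * arcsin x) / (pi / 2 * sqrt (1 - x\<^sup>2)))"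
  proof (intro continuous_intros continuous_on_compose2[OF continuous_angle_density[OF \<beta>, of UNIV]])
    show "\<forall>x\<in>{-1<..<1}. pi / 2 * sqrt (1 - x\<^sup>2) \<noteq> 0"
    proof
      fix x :: real assume "x \<in> {-1<..<1}"
      then have "x\<^sup>2 < 1" by (auto simp: abs_square_less_1)
      then show "pi / 2 * sqrt (1 - x\<^sup>2) \<noteq> 0" by simp
    qed
  qed auto
  then show ?thesis
    by (rule continuous_on_eq) (auto simp: slit_density_def)
qed

lemma borel_measurable_slit_density [measurable]: "slit_density \<alpha> \<beta> \<in> borel_measurable borel"
proof -
  have "(\<lambda>x. indicator {-1<..<1} x *\<^sub>R slit_density \<alpha> \<beta> (of_real x)) \<in> borel_measurable borel"
    by (intro borel_measurable_continuous_on_indicator continuous_on_slit_density_interval) simp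
  then have "(\<lambda>z. indicator {-1<..<1} (Re z) *\<^sub>R slit_density \<alpha> \<beta> (of_real (Re z))) \<in> borel_measurable borel"
    by (rule measurable_compose[rotated]) simp
  also have "(\<lambda>z. indicator {-1<..<1} (Re z) *\<^sub>R slit_density \<alpha> \<beta> (of_real (Re z))) = slit_density \<alpha> \<beta>"
    by (auto simp: fun_eq_iff slit_density_def indicator_def)
  finally show ?thesis .
qed

lemma slit_density_integral_1:
  "(\<integral>\<^sup>+x. ennreal (slit_density \<alpha> \<beta> (of_real x)) \<partial>lborel) = 1"
proof -
  define r where "r x = slit_density \<alpha> \<beta> (of_real x)" for x :: real
  have rm[measurable]: "r \<in> borel_measurable borel" unfolding r_def by simp
  have am[measurable]: "angle_density \<alpha> \<beta> \<in> borel_measurable borel"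
    by (intro borel_measurable_continuous_onI continuous_angle_density \<beta>)
  have s: "sin (pi / 2 * (-1)) = -1" "sin (pi / 2 * 1) = 1" by simp_all
  have "(\<integral>\<^sup>+x. ennreal (r x) \<partial>lborel) = (\<integral>\<^sup>+x. ennreal (r x * indicator {sin (pi / 2 * (-1))..sin (pi / 2 * 1)} x) \<partial>lborel)"
    unfolding s by (intro nn_integral_cong) (auto simp: r_def slit_density_def indicator_def)
  also have "\<dots> = (\<integral>\<^sup>+x. ennreal (r (sin (pi / 2 * x)) * (cos (pi / 2 * x) * (pi / 2)) * indicator {-1..1} x) \<partial>lborel)"
  proof (rule nn_integral_substitution)
    show "set_borel_measurable borel {sin (pi / 2 * (-1))..sin (pi / 2 * 1)} r"
      unfolding set_borel_measurable_def by measurable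
    show "((\<lambda>x. sin (pi / 2 * x)) has_real_derivative cos (pi / 2 * x) * (pi / 2)) (at x)" for x
      by (auto intro!: derivative_eq_intros)
    show "continuous_on {-1..1} (\<lambda>x. cos (pi / 2 * x) * (pi / 2))" by (intro continuous_intros)
    show "cos (pi / 2 * x) * (pi / 2) \<ge> 0" if "x \<in> {-1..1}" for x
      using that mult_left_mono[of "-1" x pi] by (intro mult_nonneg_nonneg cos_ge_zero) auto
  qed simp
  also have "\<dots> = (\<integral>\<^sup>+x. ennreal (angle_density \<alpha> \<beta> x * indicator {-1..1} x) \<partial>lborel)"
  proof (intro nn_integral_cong_AE)
    have "AE x in lborel. x \<noteq> (1::real)" "AE x in lborel. x \<noteq> (-1::real)" by (rule AE_lborel_singleton)+
    then show "AE x in lborel. ennreal (r (sin (pi / 2 * x)) * (cos (pi / 2 * x) * (pi / 2)) * indicator {-1..1} x) =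
        ennreal (angle_density \<alpha> \<beta> x * indicator {-1..1} x)"
    proof eventually_elim
      case (elim x)
      then show ?case
        using slit_density_sin[of x] by (cases "x \<in> {-1<..<1}") (auto simp: r_def mult_ac indicator_def)
    qed
  qed
  also have "\<dots> = ennreal (\<integral>x. angle_density \<alpha> \<beta> x * indicator {-1..1} x \<partial>lborel)"
  proof (rule nn_integral_eq_integral)
    have "set_integrable lborel {-1..1} (angle_density \<alpha> \<beta>)"
      by (intro borel_integrable_atLeastAtMost' continuous_angle_density \<beta>)
    then show "integrable lborel (\<lambda>x. angle_density \<alpha> \<beta> x * indicator {-1..1} x)"
      by (simp add: set_integrable_def mult.commute)
  qed (auto intro!: AE_I2 mult_nonneg_nonneg angle_density_nonneg \<beta>)
  also have "(\<integral>x. angle_density \<alpha> \<beta> x * indicator {-1..1} x \<partial>lborel) = 1"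
    using angle_density_moment[OF \<beta>, of \<alpha> 0] by simp
  finally show ?thesis by (simp add: r_def)
qed

lemma slit_density_chebyshev:
  "(\<integral>x. slit_density \<alpha> \<beta> (of_real x) * chebyshev n x \<partial>lborel) =
     exp (- pi * \<beta> / 2) ^ n * cos (real n * (pi * (1 - \<alpha>) / 2))"
proof -
  define f where "f x = slit_density \<alpha> \<beta> (of_real x) * chebyshev n x" for x :: real
  have s: "sin (pi / 2 * (-1)) = -1" "sin (pi / 2 * 1) = 1" by simp_all
  have ind: "f x * indicator {-1..1} x = f x" for x by (auto simp: f_def slit_density_def indicator_def)
  have intr: "integrable lborel (\<lambda>x. slit_density \<alpha> \<beta> (of_real x))"
    using slit_density_integral_1 slit_density_nonneg by (intro integrableI_nonneg) auto
  have int: "integrable lborel f"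
    unfolding f_def
  proof (rule Bochner_Integration.integrable_bound[OF intr])
    show "AE x in lborel. norm (slit_density \<alpha> \<beta> (of_real x) * chebyshev n x) \<le> norm (slit_density \<alpha> \<beta> (of_real x))"
      using abs_chebyshev_le_1[of n] slit_density_nonneg by (auto simp: abs_mult intro!: mult_left_le)
  qed simp
  have "(\<integral>x. f x \<partial>lborel) = (\<integral>x. f x * indicator {sin (pi / 2 * (-1))..sin (pi / 2 * 1)} x \<partial>lborel)"
    unfolding s ind ..
  also have "\<dots> = (\<integral>x. f (sin (pi / 2 * x)) * (cos (pi / 2 * x) * (pi / 2)) * indicator {-1..1} x \<partial>lborel)"
  proof (rule integral_substitution(2))
    show "set_integrable lborel {sin (pi / 2 * (-1))..sin (pi / 2 * 1)} f"
      unfolding s set_integrable_def using int by (simp add: mult.commute[of "indicator _ _"] ind)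
    show "((\<lambda>x. sin (pi / 2 * x)) has_real_derivative cos (pi / 2 * x) * (pi / 2)) (at x)" for x
      by (auto intro!: derivative_eq_intros)
    show "continuous_on {-1..1} (\<lambda>x. cos (pi / 2 * x) * (pi / 2))" by (intro continuous_intros)
    show "cos (pi / 2 * x) * (pi / 2) \<ge> 0" if "x \<in> {-1..1}" for x
      using that mult_left_mono[of "-1" x pi] by (intro mult_nonneg_nonneg cos_ge_zero) auto
  qed simp
  also have "\<dots> = (\<integral>x. angle_density \<alpha> \<beta> x * cos (real n * (pi * (1 - x) / 2)) * indicator {-1..1} x \<partial>lborel)"
  proof (rule integral_cong_AE)
    show "(\<lambda>x. f (sin (pi / 2 * x)) * (cos (pi / 2 * x) * (pi / 2)) * indicator {-1..1} x) \<in> borel_measurable lborel"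
      unfolding f_def by measurable
    have [measurable]: "angle_density \<alpha> \<beta> \<in> borel_measurable borel"
      by (intro borel_measurable_continuous_onI continuous_angle_density \<beta>)
    show "(\<lambda>x. angle_density \<alpha> \<beta> x * cos (real n * (pi * (1 - x) / 2)) * indicator {-1..1} x) \<in> borel_measurable lborel"
      by measurable
    have "AE x in lborel. x \<noteq> (1::real)" "AE x in lborel. x \<noteq> (-1::real)" by (rule AE_lborel_singleton)+
    then show "AE x in lborel. f (sin (pi / 2 * x)) * (cos (pi / 2 * x) * (pi / 2)) * indicator {-1..1} x =
        angle_density \<alpha> \<beta> x * cos (real n * (pi * (1 - x) / 2)) * indicator {-1..1} x"
    proof eventually_elim
      case (elim x)
      show ?case
      proof (cases "x \<in> {-1<..<1}")
        case True
        have "sin (pi / 2 * x) = cos (pi * (1 - x) / 2)"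
          by (simp add: sin_cos_eq algebra_simps diff_divide_distrib)
        moreover have "arccos (cos (pi * (1 - x) / 2)) = pi * (1 - x) / 2"
          using True mult_left_mono[of "1 - x" 2 pi] by (intro arccos_cos) auto
        ultimately have "chebyshev n (sin (pi / 2 * x)) = cos (real n * (pi * (1 - x) / 2))"
          by (simp only: chebyshev_eq abs_cos_le_one)
        then have "f (sin (pi / 2 * x)) * (cos (pi / 2 * x) * (pi / 2)) =
            (pi / 2 * cos (pi / 2 * x) * slit_density \<alpha> \<beta> (of_real (sin (pi / 2 * x)))) * cos (real n * (pi * (1 - x) / 2))"
          by (simp add: f_def mult_ac)
        then show ?thesis unfolding slit_density_sin[OF True] by simp
      qed (use elim in \<open>auto simp: indicator_def\<close>)
    qed
  qed
  also have "\<dots> = exp (- pi * \<beta> / 2) ^ n * cos (real n * (pi * (1 - \<alpha>) / 2))"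
    by (rule angle_density_moment[OF \<beta>])
  finally show ?thesis by (simp add: f_def)
qed

end

text \<open>For \<open>\<zeta> = \<pi> (\<alpha> + \<beta> \<i>) / 2\<close> the identity \<open>2 sin \<zeta> = v + 1/v\<close> holds with \<open>v = - \<i> exp (\<i> \<zeta>)\<close>, and
\<open>\<beta> > 0\<close> says that \<open>v\<close> is inside the disc.\<close>

lemma joukowski_inv_sin:
  assumes "\<beta> > 0"
  shows "Re (joukowski_inv (sin (of_real (pi / 2) * (of_real \<alpha> + of_real \<beta> * \<i>))) ^ n) =
    exp (- pi * \<beta> / 2) ^ n * cos (real n * (pi * (1 - \<alpha>) / 2))"
proof -
  define \<zeta> where "\<zeta> = of_real (pi / 2) * (of_real \<alpha> + of_real \<beta> * \<i>)"
  define v where "v = - \<i> * exp (\<i> * \<zeta>)"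
  have v: "v = of_real (exp (- pi * \<beta> / 2)) * cis (- (pi * (1 - \<alpha>) / 2))"
  proof -
    have "- \<i> = cis (- (pi / 2))" by (simp add: complex_eq_iff)
    then have "v = exp (\<i> * of_real (- (pi / 2))) * exp (\<i> * \<zeta>)"
      by (simp only: v_def cis_conv_exp)
    also have "\<dots> = exp (of_real (- pi * \<beta> / 2) + \<i> * of_real (- (pi * (1 - \<alpha>) / 2)))"
      unfolding exp_add[symmetric] by (rule arg_cong[where f = exp]) (simp add: \<zeta>_def complex_eq_iff field_simps)
    also have "\<dots> = of_real (exp (- pi * \<beta> / 2)) * cis (- (pi * (1 - \<alpha>) / 2))"
      by (simp only: exp_add exp_of_real cis_conv_exp)
    finally show ?thesis .
  qed
  have J: "joukowski_inv (sin \<zeta>) = v"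
  proof (rule joukowski_inv_unique)
    show "norm v < 1" unfolding v using assms by (simp add: norm_mult)
    show "v \<noteq> 0" by (simp add: v_def)
    have "inverse v = \<i> * exp (- (\<i> * \<zeta>))" by (simp add: v_def exp_minus field_simps)
    then show "v + inverse v = 2 * sin \<zeta>"
      by (simp add: v_def sin_exp_eq field_simps)
  qed
  have "Re (v ^ n) = exp (- pi * \<beta> / 2) ^ n * cos (real n * (pi * (1 - \<alpha>) / 2))"
    unfolding v power_mult_distrib Complex.DeMoivre by (simp flip: of_real_power)
  then show ?thesis unfolding \<zeta>_def[symmetric] J .
qed

theorem mainTheorem10:
  fixes M :: "'a measure" and B :: "real \<Rightarrow> 'a \<Rightarrow> complex" and \<alpha> \<beta> :: real
  assumes "\<beta> > 0"
    and "planar_brownian_motion M B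
           (sin (complex_of_real (pi / 2) * (complex_of_real \<alpha> + complex_of_real \<beta> * \<i>)))"
  shows "(\<exists>\<rho>. segment_hitting_density M B \<rho>) \<and>
    (\<forall>\<rho>. segment_hitting_density M B \<rho> \<longrightarrow>
      (\<forall>x\<in>{-1<..<1}.
        pi / 2 * cos (pi / 2 * x) * \<rho> (complex_of_real (sin (pi / 2 * x))) =
        1 / pi * (\<Sum>\<^sub>\<infinity>n\<in>(UNIV :: int set).
          \<beta> / (\<beta>\<^sup>2 + (\<alpha> - (2 * real_of_int n + (-1) powi n * x))\<^sup>2))))"
proof -
  note \<beta> = assms(1)
  interpret planar_brownian_motion M B "sin (complex_of_real (pi / 2) * (complex_of_real \<alpha> + complex_of_real \<beta> * \<i>))"
    by (rule assms(2))
  define X where "X = hitting_point B slit"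
  have Xm[measurable]: "X \<in> borel_measurable M" unfolding X_def by (rule hitting_point_measurable)
  have Xslit: "AE \<omega> in M. X \<omega> \<in> slit" unfolding X_def by (rule hitting_point_in_slit)
  define \<mu> where "\<mu> = distr M borel (\<lambda>\<omega>. Re (X \<omega>))"
  define r where "r x = slit_density \<alpha> \<beta> (of_real x)" for x :: real
  have rm[measurable]: "r \<in> borel_measurable borel" unfolding r_def using borel_measurable_slit_density[OF \<beta>] by simp
  note [measurable] = borel_measurable_slit_density[OF \<beta>]
  have r0: "r x \<ge> 0" for x unfolding r_def by (rule slit_density_nonneg[OF \<beta>])
  define \<nu> where "\<nu> = density lborel (\<lambda>x. ennreal (r x))"
  have "\<mu> = \<nu>"
  proof (rule real_distribution_eqI_chebyshev)
    show "real_distribution \<mu>" unfolding \<mu>_def by (rule real_distribution_distr) simp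
    show "real_distribution \<nu>"
    proof -
      have "prob_space \<nu>"
        by (rule prob_spaceI) (simp add: \<nu>_def emeasure_density slit_density_integral_1[OF \<beta>] r_def)
      then show ?thesis by (simp add: real_distribution_def real_distribution_axioms_def \<nu>_def)
    qed
    show "AE x in \<mu>. \<bar>x\<bar> \<le> 1"
      unfolding \<mu>_def using Xslit by (subst AE_distr_iff) (auto simp: mem_unit_segment_iff elim!: eventually_mono)
    have "AE x in lborel. 0 < ennreal (r x) \<longrightarrow> \<bar>x\<bar> \<le> 1" by (auto simp: r_def slit_density_def)
    then show "AE x in \<nu>. \<bar>x\<bar> \<le> 1" unfolding \<nu>_def by (subst AE_density) auto
    show "(\<integral>x. chebyshev n x \<partial>\<mu>) = (\<integral>x. chebyshev n x \<partial>\<nu>)" for n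
    proof -
      have "(\<integral>x. chebyshev n x \<partial>\<mu>) = expectation (\<lambda>\<omega>. chebyshev n (Re (X \<omega>)))"
        unfolding \<mu>_def by (subst integral_distr) auto
      also have "\<dots> = expectation (\<lambda>\<omega>. Re (joukowski_inv (X \<omega>) ^ n))"
      proof (rule integral_cong_AE)
        show "AE \<omega> in M. chebyshev n (Re (X \<omega>)) = Re (joukowski_inv (X \<omega>) ^ n)"
          using Xslit
        proof eventually_elim
          case (elim \<omega>)
          then have "of_real (Re (X \<omega>)) = X \<omega>" by (simp add: mem_unit_segment_iff complex_eq_iff)
          then show ?case by (simp add: chebyshev_def)
        qed
        have "(\<lambda>z. Re (joukowski_inv z ^ n)) \<in> borel_measurable borel"
          by (intro borel_measurable_continuous_onI continuous_on_Re_joukowski_inv_power)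
        then show "(\<lambda>\<omega>. Re (joukowski_inv (X \<omega>) ^ n)) \<in> borel_measurable M"
          by (rule measurable_compose[OF Xm])
      qed simp
      also have "\<dots> = exp (- pi * \<beta> / 2) ^ n * cos (real n * (pi * (1 - \<alpha>) / 2))"
        unfolding X_def hitting_point_chebyshev_moment by (rule joukowski_inv_sin[OF \<beta>])
      also have "\<dots> = (\<integral>x. r x * chebyshev n x \<partial>lborel)"
        unfolding r_def by (rule slit_density_chebyshev[OF \<beta>, symmetric])
      also have "\<dots> = (\<integral>x. chebyshev n x \<partial>\<nu>)"
        unfolding \<nu>_def by (subst integral_real_density) (auto simp: r0)
      finally show ?thesis .
    qed
  qed
  have arc_sets: "sets segment_arclength = sets borel" by (simp add: segment_arclength_def)
  \<comment> \<open>The hitting point equals its real part almost surely, so its law in the plane is the image of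
    the law on the line.\<close>
  have law: "distr M segment_arclength X = density segment_arclength (\<lambda>z. ennreal (slit_density \<alpha> \<beta> z))"
  proof (rule measure_eqI)
    fix A assume "A \<in> sets (distr M segment_arclength X)"
    then have A[measurable]: "A \<in> sets borel" by (simp add: arc_sets)
    have "emeasure (distr M segment_arclength X) A = emeasure (distr M borel X) A"
      by (simp add: arc_sets cong: distr_cong)
    also have "distr M borel X = distr M borel (\<lambda>\<omega>. complex_of_real (Re (X \<omega>)))"
    proof (rule distr_cong_AE)
      show "AE \<omega> in M. X \<omega> = complex_of_real (Re (X \<omega>))"
        using Xslit by eventually_elim (simp add: mem_unit_segment_iff complex_eq_iff)
    qed simp_all
    also have "\<dots> = distr \<mu> borel complex_of_real"
      unfolding \<mu>_def by (subst distr_distr) (auto simp: o_def)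
    also have "\<dots> = distr \<nu> borel complex_of_real" by (simp add: \<open>\<mu> = \<nu>\<close>)
    also have "emeasure (distr \<nu> borel complex_of_real) A = (\<integral>\<^sup>+x. ennreal (r x) * indicator A (of_real x) \<partial>lborel)"
      unfolding \<nu>_def using measurable_sets_borel[OF borel_measurable_of_real A]
      by (subst emeasure_distr) (auto simp: emeasure_density indicator_def intro!: nn_integral_cong)
    also have "\<dots> = (\<integral>\<^sup>+x. ennreal (r x) * indicator A (of_real x) \<partial>restrict_space lborel {-1..1})"
      by (subst nn_integral_restrict_space)
        (auto simp: r_def slit_density_def indicator_def intro!: nn_integral_cong)
    also have "\<dots> = (\<integral>\<^sup>+z. ennreal (slit_density \<alpha> \<beta> z) * indicator A z \<partial>segment_arclength)"
      unfolding segment_arclength_def r_def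
      by (subst nn_integral_distr) (auto intro!: measurable_restrict_space1)
    also have "\<dots> = emeasure (density segment_arclength (\<lambda>z. ennreal (slit_density \<alpha> \<beta> z))) A"
      by (subst emeasure_density) (auto simp: arc_sets measurable_cong_sets[OF arc_sets refl])
    finally show "emeasure (distr M segment_arclength X) A =
        emeasure (density segment_arclength (\<lambda>z. ennreal (slit_density \<alpha> \<beta> z))) A" .
  qed simp
  have dist: "distributed M segment_arclength X (\<lambda>z. ennreal (slit_density \<alpha> \<beta> z))"
    unfolding distributed_def using law
    by (auto simp: measurable_cong_sets[OF refl arc_sets] measurable_cong_sets[OF arc_sets refl])
  have open_seg: "z \<in> open_segment (-1) 1 \<longleftrightarrow> z = of_real (Re z) \<and> Re z \<in> {-1<..<1}" for z :: complex
    by (auto simp: open_segment_def mem_unit_segment_iff complex_eq_iff)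
  have "continuous_on (open_segment (-1) 1) (\<lambda>z. slit_density \<alpha> \<beta> (of_real (Re z)))"
    by (rule continuous_on_compose2[OF continuous_on_slit_density_interval[OF \<beta>]])
      (auto simp: open_seg intro!: continuous_intros)
  then have cont: "continuous_on (open_segment (-1) 1) (slit_density \<alpha> \<beta>)"
    by (rule continuous_on_eq) (simp add: slit_density_def)
  have ex: "segment_hitting_density M B (slit_density \<alpha> \<beta>)"
    unfolding segment_hitting_density_def
    using hits_almost_surely dist cont slit_density_nonneg[OF \<beta>] by (auto simp: X_def)
  have unique: "pi / 2 * cos (pi / 2 * x) * \<rho> (complex_of_real (sin (pi / 2 * x))) = angle_density \<alpha> \<beta> x"
    if \<rho>: "segment_hitting_density M B \<rho>" and x: "x \<in> {-1<..<1}" for \<rho> x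
  proof -
    have d\<rho>: "distributed M segment_arclength X (\<lambda>z. ennreal (\<rho> z))"
      and \<rho>0: "\<And>z. z \<in> slit \<Longrightarrow> 0 \<le> \<rho> z" and \<rho>c: "continuous_on (open_segment (-1) 1) \<rho>"
      using \<rho> by (auto simp: segment_hitting_density_def X_def)
    have "prob_space (density segment_arclength (\<lambda>z. ennreal (slit_density \<alpha> \<beta> z)))"
      unfolding law[symmetric] using dist by (intro prob_space_distr) (auto simp: distributed_def)
    then have "sigma_finite_measure (density segment_arclength (\<lambda>z. ennreal (slit_density \<alpha> \<beta> z)))"
      by (rule prob_space_imp_sigma_finite)
    then have "AE z in segment_arclength. ennreal (\<rho> z) = ennreal (slit_density \<alpha> \<beta> z)"
      using d\<rho> dist by (intro sigma_finite_density_unique[THEN iffD1]) (auto simp: distributed_def)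
    then have "AE x in restrict_space lborel {-1..1}. ennreal (\<rho> (of_real x)) = ennreal (slit_density \<alpha> \<beta> (of_real x))"
      unfolding segment_arclength_def by (rule AE_distrD[rotated]) (auto intro!: measurable_restrict_space1)
    then have "AE x in lborel. x \<in> {-1..1} \<longrightarrow> ennreal (\<rho> (of_real x)) = ennreal (slit_density \<alpha> \<beta> (of_real x))"
      by (subst (asm) AE_restrict_space_iff) auto
    then have ae: "AE x in lborel. x \<in> {-1..1} \<longrightarrow> \<rho> (of_real x) = slit_density \<alpha> \<beta> (of_real x)"
      by eventually_elim (use \<rho>0 slit_density_nonneg[OF \<beta>] in \<open>auto simp: of_real_in_slit abs_le_iff\<close>)
    define g where "g t = \<rho> (of_real t) - slit_density \<alpha> \<beta> (of_real t)" for t :: real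
    have gc: "continuous_on {-1<..<1} g"
      unfolding g_def
      by (intro continuous_on_diff continuous_on_slit_density_interval \<beta> continuous_on_compose2[OF \<rho>c])
        (auto simp: open_seg intro!: continuous_intros)
    \<comment> \<open>Two continuous functions that agree almost everywhere agree everywhere: the open set \<open>D\<close> where
      they differ is null, hence empty.\<close>
    define D where "D = {-1<..<1} \<inter> g -` (- {0})"
    have "open D" unfolding D_def using gc by (intro continuous_open_preimage) auto
    moreover have "AE t \<in> D in lebesgue. t \<in> {}"
      using AE_completion[OF ae] by eventually_elim (auto simp: D_def g_def)
    ultimately have "t \<notin> D" for t using mem_closed_if_AE_lebesgue_open[of D "{}"] by blast
    moreover have "sin (pi / 2 * x) \<in> {-1<..<1}"
    proof -
      have "cos (pi / 2 * x) > 0" 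
        using x mult_strict_left_mono[of "-1" x "pi / 2"] mult_strict_left_mono[of x 1 "pi / 2"]
        by (intro cos_gt_zero_pi) auto
      then have "(sin (pi / 2 * x))\<^sup>2 < 1" by (simp add: sin_squared_eq)
      then show ?thesis by (auto simp: abs_square_less_1 abs_less_iff)
    qed
    ultimately have "g (sin (pi / 2 * x)) = 0" by (auto simp: D_def)
    then have "\<rho> (of_real (sin (pi / 2 * x))) = slit_density \<alpha> \<beta> (of_real (sin (pi / 2 * x)))" by (simp add: g_def)
    then show ?thesis using slit_density_sin[OF \<beta> x] by simp
  qed
  show ?thesis using ex unique unfolding angle_density_def by blast
qed

end
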